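(* There exist absolute constants $c,c',c''>0$ such that the following holds. Let $C_1$ and $C_2$ be two circles in $\mathbb{R}^3$, and let $m,n\ge 1$ be integers. (a) Assume that $C_1$ and $C_2$ are aligned or perpendicular. Then there exist a set $\mathcal{P}_1\subset C_1$ of $m$ points and a set $\mathcal{P}_2\subset C_2$ of $n$ points such that \[ c'(m+n)\le D(\mathcal{P}_1,\mathcal{P}_2)\le c''(m+n). \] (b) Assume that $C_1$ and $C_2$ are neither aligned nor perpendicular. Let $\mathcal{P}_1\subset C_1$ be a set of $m$ points and let $\mathcal{P}_2\subset C_2$ be a set of $n$ points. Then \[ D(\mathcal{P}_1,\mathcal{P}_2)\ \ge\ c\,\min\left\{m^{2/3}n^{2/3},\,m^2,\,n^2\right\}. \]
   Context: For finite sets $\mathcal{P}_1,\mathcal{P}_2\subset\mathbb{R}^3$, $D(\mathcal{P}_1,\mathcal{P}_2)$ is the number of distinct Euclidean distances $|ab|$ over all pairs $(a,b)\in\mathcal{P}_1\times\mathcal{P}_2$. Circles have positive radius. The axis of a circle $C$ in $\mathbb{R}^3$ is the line incident to the center of $C$ and orthogonal to the plane containing $C$. Two circles $C_1$ and $C_2$ in $\mathbb{R}^3$ are aligned if they have the same line as their axis. Let $H_1$ be the plane containing $C_1$ and $H_2$ the plane containing $C_2$. The circles $C_1$ and $C_2$ are perpendicular if all of the following hold: (1) the planes $H_1$ and $H_2$ are perpendicular; (2) the center of $C_1$ lies on $H_2$; (3) the center of $C_2$ lies on $H_1$. *)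

theory Defs
  imports "HOL-Analysis.Analysis"
begin

definition is_plane :: "(real^3) set \<Rightarrow> bool" where
  "is_plane H \<longleftrightarrow> affine H \<and> aff_dim H = 2"

definition is_circle :: "(real^3) set \<Rightarrow> bool" where
  "is_circle C \<longleftrightarrow> (\<exists>H p r. is_plane H \<and> p \<in> H \<and> r > 0 \<and> C = sphere p r \<inter> H)"

text \<open>The definite descriptions below are meaningful only for circles; that the plane and
  the centre of a circle are then uniquely determined is shown by the lemmas
  \<open>circle_plane_eq\<close> and \<open>circle_center_eq\<close>.\<close>

definition circle_plane :: "(real^3) set \<Rightarrow> (real^3) set" where
  "circle_plane C = (THE H. is_plane H \<and> C \<subseteq> H)"

definition circle_center :: "(real^3) set \<Rightarrow> real^3" where
  "circle_center C =
     (THE p. p \<in> circle_plane C \<and> (\<exists>r>0. C = sphere p r \<inter> circle_plane C))"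

definition circle_axis :: "(real^3) set \<Rightarrow> (real^3) set" where
  "circle_axis C =
     {x. \<forall>y\<in>circle_plane C. orthogonal (x - circle_center C) (y - circle_center C)}"

definition aligned :: "(real^3) set \<Rightarrow> (real^3) set \<Rightarrow> bool" where
  "aligned C1 C2 \<longleftrightarrow> circle_axis C1 = circle_axis C2"

definition plane_normal :: "(real^3) set \<Rightarrow> real^3 \<Rightarrow> bool" where
  "plane_normal H u \<longleftrightarrow> u \<noteq> 0 \<and> (\<forall>x\<in>H. \<forall>y\<in>H. orthogonal u (x - y))"

definition perpendicular_planes :: "(real^3) set \<Rightarrow> (real^3) set \<Rightarrow> bool" where
  "perpendicular_planes H1 H2 \<longleftrightarrow>
     (\<exists>u v. plane_normal H1 u \<and> plane_normal H2 v \<and> orthogonal u v)"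

definition perpendicular_circles :: "(real^3) set \<Rightarrow> (real^3) set \<Rightarrow> bool" where
  "perpendicular_circles C1 C2 \<longleftrightarrow>
     perpendicular_planes (circle_plane C1) (circle_plane C2) \<and>
     circle_center C1 \<in> circle_plane C2 \<and>
     circle_center C2 \<in> circle_plane C1"

definition num_distances :: "(real^3) set \<Rightarrow> (real^3) set \<Rightarrow> nat" where
  "num_distances P1 P2 = card {dist a b | a b. a \<in> P1 \<and> b \<in> P2}"

lemma circle_affine_hull:
  fixes p :: "real^3"
  assumes H: "is_plane H" and p: "p \<in> H" and r: "r > 0"
  shows "affine hull (sphere p r \<inter> H) = H"
proof
  have aff: "affine H" using H by (simp add: is_plane_def)
  then show "affine hull (sphere p r \<inter> H) \<subseteq> H" by (simp add: hull_minimal)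
  have step: "p + t *\<^sub>R (x - p) \<in> H" if "x \<in> H" for x t
    using mem_affine[OF aff p that, of "1 - t" t] by (simp add: algebra_simps)
  obtain x0 where x0: "x0 \<in> H" "x0 \<noteq> p"
  proof -
    have "\<not> H \<subseteq> {p}"
    proof
      assume "H \<subseteq> {p}"
      then have "aff_dim H \<le> aff_dim {p}" by (rule aff_dim_subset)
      then show False using H by (simp add: is_plane_def)
    qed
    then show ?thesis using that by blast
  qed
  define S where "S = affine hull (sphere p r \<inter> H)"
  have affS: "affine S" by (simp add: S_def)
  have onS: "p + t *\<^sub>R (x - p) \<in> S" if "x \<in> H" "x \<noteq> p" "\<bar>t\<bar> * norm (x - p) = r" for x t
    unfolding S_def by (rule hull_inc) (use that step in \<open>simp add: dist_norm\<close>)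
  have line: "p + t *\<^sub>R (x - p) \<in> S" if x: "x \<in> H" "x \<noteq> p" for x t
  proof -
    define k where "k = r / norm (x - p)"
    have k: "k > 0" and kr: "k * norm (x - p) = r" using x r by (auto simp: k_def)
    have 1: "p + k *\<^sub>R (x - p) \<in> S" "p + (- k) *\<^sub>R (x - p) \<in> S"
      using onS[OF x, of k] onS[OF x, of "- k"] k kr by simp_all
    define a where "a = (1 + t / k) / 2"
    have "a *\<^sub>R (p + k *\<^sub>R (x - p)) + (1 - a) *\<^sub>R (p + (- k) *\<^sub>R (x - p)) \<in> S"
      by (rule mem_affine[OF affS 1]) simp
    also have "a *\<^sub>R (p + k *\<^sub>R (x - p)) + (1 - a) *\<^sub>R (p + (- k) *\<^sub>R (x - p))
        = p + ((2 * a - 1) * k) *\<^sub>R (x - p)"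
      by (simp add: algebra_simps flip: scaleR_add_left)
    also have "(2 * a - 1) * k = t" using k by (simp add: a_def field_simps)
    finally show ?thesis .
  qed
  show "H \<subseteq> affine hull (sphere p r \<inter> H)"
  proof
    fix x assume x: "x \<in> H"
    show "x \<in> affine hull (sphere p r \<inter> H)"
      using line[of x 1] line[OF x0, of 0] x by (cases "x = p") (auto simp: S_def)
  qed
qed

lemma circle_plane_eq:
  fixes p :: "real^3"
  assumes H: "is_plane H" and p: "p \<in> H" and r: "r > 0"
  shows "circle_plane (sphere p r \<inter> H) = H"
  unfolding circle_plane_def
proof (rule the_equality)
  show "is_plane H \<and> sphere p r \<inter> H \<subseteq> H" using H by simp
next
  fix K assume K: "is_plane K \<and> sphere p r \<inter> H \<subseteq> K"
  then have "affine hull (sphere p r \<inter> H) \<subseteq> K"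
    by (simp add: hull_minimal is_plane_def)
  then have sub: "H \<subseteq> K" using circle_affine_hull[OF assms] by simp
  have "H \<noteq> {}" using p by blast
  then show "K = H"
    using affine_dim_equal[OF _ _ _ sub] H K by (simp add: is_plane_def)
qed

lemma circle_center_unique:
  fixes p q :: "real^3"
  assumes H: "is_plane H" and p: "p \<in> H" "r > 0" and q: "q \<in> H" "s > 0"
    and eq: "sphere p r \<inter> H = sphere q s \<inter> H"
  shows "q = p"
proof (rule ccontr)
  assume ne: "q \<noteq> p"
  have aff: "affine H" using H by (simp add: is_plane_def)
  define d where "d = norm (q - p)"
  have d: "d > 0" using ne by (simp add: d_def)
  have pt: "norm (p + t *\<^sub>R (q - p) - q) = s" if "\<bar>t\<bar> * d = r" for t
  proof -
    have "p + t *\<^sub>R (q - p) \<in> H"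
      using mem_affine[OF aff p(1) q(1), of "1 - t" t] by (simp add: algebra_simps)
    then have "p + t *\<^sub>R (q - p) \<in> sphere p r \<inter> H"
      using that by (simp add: dist_norm d_def)
    then show ?thesis unfolding eq by (simp add: dist_norm norm_minus_commute)
  qed
  have *: "\<bar>t - 1\<bar> * d = s" if "\<bar>t\<bar> * d = r" for t
  proof -
    have "p + t *\<^sub>R (q - p) - q = (t - 1) *\<^sub>R (q - p)" by (simp add: algebra_simps)
    then show ?thesis using pt[OF that] by (simp add: d_def)
  qed
  have "\<bar>r / d - 1\<bar> * d = \<bar>- (r / d) - 1\<bar> * d"
    using *[of "r / d"] *[of "- (r / d)"] d p(2) by simp
  then have "\<bar>r / d - 1\<bar> = \<bar>- (r / d) - 1\<bar>" using d by simp
  moreover have "r / d > 0" using d p(2) by simp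
  ultimately show False by (simp add: abs_if split: if_splits)
qed

lemma circle_center_eq:
  fixes p :: "real^3"
  assumes H: "is_plane H" and p: "p \<in> H" and r: "r > 0"
  shows "circle_center (sphere p r \<inter> H) = p"
  unfolding circle_center_def circle_plane_eq[OF assms]
  by (rule the_equality) (use assms circle_center_unique[OF H p r] in blast)+

end

theory Submission
  imports Defs
begin

text \<open>Choosing one unit vector parallel to both planes brings the squared distance between the points
  with angles \<open>s\<close> and \<open>t\<close> into the form \<open>K - k * F(s, t)\<close> with \<open>k > 0\<close> and
  \<open>F(s, t) = cos s cos t + l sin s sin t + A cos s + B sin s + C cos t + E sin t\<close>.
  The circles are aligned iff \<open>l = 1\<close> or \<open>l = -1\<close> and the other coefficients vanish, and
  perpendicular iff \<open>l = B = E = 0\<close>. In these two cases \<open>F\<close> is \<open>cos (s - l t)\<close> or, up to a constant,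
  \<open>(cos s + C) (cos t + A)\<close>, so arithmetic or geometric progressions give \<open>m + n - 1\<close> distances.

  In the remaining cases, by Cauchy-Schwarz, it suffices to bound the number of quadruples with
  \<open>F(a, b) = F(a', b')\<close>, that is, of incidences of the curves indexed by \<open>(a, a')\<close> with the
  grid of points \<open>(b, b')\<close>. As the points form a grid, cutting it into axis-parallel cells replaces the
  usual partitioning theorems. Two grid points lie on at most four common curves, apart from two kinds of
  exceptions. Writing \<open>F(a, b) = P(b) \<bullet> (cos a, sin a) + h(b)\<close>, either \<open>P(b)\<close> and \<open>P(b')\<close> have
  equal length, which happens for at most four \<open>b'\<close> for each \<open>b\<close>; or the vectors \<open>P\<close> at
  corresponding coordinates of the two grid points are parallel, which, after exchanging the circles
  if necessary, leaves each grid point at most four such partners. The at most two points with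
  \<open>P(b) = 0\<close> on each circle are discarded beforehand.\<close>

section \<open>Zeros of trigonometric polynomials\<close>

text \<open>Finiteness is part of the bound because \<open>card\<close> of an infinite set is
  0.\<close>

definition card_le :: "'a set \<Rightarrow> nat \<Rightarrow> bool" where
  "card_le S k \<longleftrightarrow> finite S \<and> card S \<le> k"

lemma card_le_subset: "card_le T k \<Longrightarrow> S \<subseteq> T \<Longrightarrow> card_le S k"
  unfolding card_le_def by (auto intro: finite_subset card_mono[THEN le_trans])

lemma card_le_inj_on: "card_le T k \<Longrightarrow> inj_on f S \<Longrightarrow> f ` S \<subseteq> T \<Longrightarrow> card_le S k"
  unfolding card_le_def
  by (auto intro: inj_on_finite order_trans[OF card_inj_on_le])

lemma card_le_Sigma:
  assumes "card_le I k" and "\<And>i. i \<in> I \<Longrightarrow> card_le (J i) l"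
  shows "card_le (Sigma I J) (k * l)"
proof -
  have "card (Sigma I J) = (\<Sum>i\<in>I. card (J i))"
    using assms by (simp add: card_le_def card_SigmaI)
  also have "\<dots> \<le> (\<Sum>i\<in>I. l)"
    using assms by (intro sum_mono) (simp add: card_le_def)
  also have "\<dots> \<le> k * l" using assms(1) by (simp add: card_le_def)
  finally show ?thesis using assms by (simp add: card_le_def)
qed

lemma card_le_Times: "card_le I k \<Longrightarrow> card_le J l \<Longrightarrow> card_le (I \<times> J) (k * l)"
  by (rule card_le_Sigma)

lemma card_le_Un: "card_le S k \<Longrightarrow> card_le T l \<Longrightarrow> card_le (S \<union> T) (k + l)"
  unfolding card_le_def by (auto intro: order_trans[OF card_Un_le add_mono])

text \<open>Half-open, so that each point of a circle has exactly one angle.\<close>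

abbreviation full_turn :: "real set" where "full_turn \<equiv> {0..<2 * pi}"

lemma inj_on_cis: "inj_on cis full_turn"
proof (rule inj_onI)
  fix s t assume st: "s \<in> full_turn" "t \<in> full_turn" "cis s = cis t"
  then have "cos s = cos t" "sin s = sin t" by (auto simp: complex_eq_iff)
  then obtain n :: int where n: "s = t + 2 * pi * n" using sin_cos_eq_iff by blast
  moreover have "\<bar>s - t\<bar> < 2 * pi" using st by auto
  ultimately have "2 * pi * \<bar>real_of_int n\<bar> < 2 * pi * 1" by (simp add: abs_mult)
  then have "\<bar>real_of_int n\<bar> < 1" by (subst (asm) mult_less_cancel_left_pos) auto
  then have "n = 0" by linarith
  with n show "s = t" by simp
qed

lemma card_le_cis_roots:
  assumes "p \<noteq> 0" and "degree p \<le> k"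
  shows "card_le {t \<in> full_turn. poly p (cis t) = 0} k"
proof (rule card_le_inj_on)
  show "card_le {z. poly p z = 0} k"
    using assms poly_roots_finite[of p] card_poly_roots_bound[of p] by (auto simp: card_le_def)
  show "inj_on cis {t \<in> full_turn. poly p (cis t) = 0}"
    by (rule inj_on_subset[OF inj_on_cis]) auto
qed auto

text \<open>Up to the factor \<open>(cis t)^2\<close>, the trigonometric polynomial is a nonzero
  complex polynomial of degree at most four in \<open>cis t\<close>, and \<open>cis\<close> is
  injective on a full turn.\<close>

lemma trig_poly2_zeros:
  fixes a0 a1 b1 a2 b2 :: real
  assumes nz: "\<not> (a0 = 0 \<and> a1 = 0 \<and> b1 = 0 \<and> a2 = 0 \<and> b2 = 0)"
  shows "card_le {t \<in> full_turn. a0 + a1 * cos t + b1 * sin t + a2 * cos (2 * t) + b2 * sin (2 * t) = 0} 4"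
proof -
  \<comment> \<open>The coefficients are halved because a1 cos t + b1 sin t is
    \<open>w1 * cis t\<close> plus its conjugate. Conjugation inverts \<open>cis t\<close>, so the
    coefficients of \<open>p\<close> come in conjugate pairs.\<close>
  define w1 w2 where "w1 = Complex (a1 / 2) (- b1 / 2)" and "w2 = Complex (a2 / 2) (- b2 / 2)"
  define p where "p = [:cnj w2, cnj w1, of_real a0, w1, w2:]"
  have "p \<noteq> 0" using nz by (auto simp: p_def w1_def w2_def complex_eq_iff)
  moreover have "degree p \<le> 4" by (simp add: p_def)
  moreover have "poly p (cis t) = (cis t)^2 *
      of_real (a0 + a1 * cos t + b1 * sin t + a2 * cos (2 * t) + b2 * sin (2 * t))" for t
  proof -
    have c: "cis t * cis (- t) = 1" by (simp add: cis_mult)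
    have 1: "w1 * cis t + cnj w1 * cis (- t) = of_real (a1 * cos t + b1 * sin t)"
      by (simp add: w1_def complex_eq_iff field_simps)
    have 2: "w2 * (cis t)^2 + cnj w2 * (cis (- t))^2 = of_real (a2 * cos (2*t) + b2 * sin (2*t))"
      unfolding Complex.DeMoivre by (simp add: w2_def complex_eq_iff field_simps)
    have "poly p (cis t) = (cis t)^2 * (of_real a0 + (w1 * cis t + cnj w1 * cis (- t))
        + (w2 * (cis t)^2 + cnj w2 * (cis (- t))^2))"
      using c by (simp add: p_def) algebra
    then show ?thesis unfolding 1 2 by simp
  qed
  ultimately show ?thesis
    using card_le_cis_roots[of p 4] by (auto intro: card_le_subset simp del: of_real_add)
qed

lemma trig_poly1_zeros:
  fixes a0 a1 b1 :: real
  assumes nz: "\<not> (a0 = 0 \<and> a1 = 0 \<and> b1 = 0)"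
  shows "card_le {t \<in> full_turn. a0 + a1 * cos t + b1 * sin t = 0} 2"
proof -
  define w1 where "w1 = Complex (a1 / 2) (- b1 / 2)"
  define p where "p = [:cnj w1, of_real a0, w1:]"
  have "p \<noteq> 0" using nz by (auto simp: p_def w1_def complex_eq_iff)
  moreover have "degree p \<le> 2" by (simp add: p_def)
  moreover have "poly p (cis t) = cis t * of_real (a0 + a1 * cos t + b1 * sin t)" for t
  proof -
    have c: "cis t * cis (- t) = 1" by (simp add: cis_mult)
    have 1: "w1 * cis t + cnj w1 * cis (- t) = of_real (a1 * cos t + b1 * sin t)"
      by (simp add: w1_def complex_eq_iff field_simps)
    have "poly p (cis t) = cis t * (of_real a0 + (w1 * cis t + cnj w1 * cis (- t)))"
      using c by (simp add: p_def) algebra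
    then show ?thesis unfolding 1 by simp
  qed
  ultimately show ?thesis
    using card_le_cis_roots[of p 2] by (auto intro: card_le_subset simp del: of_real_add)
qed

text \<open>Solving the two equations for the primed unit vector makes it an affine image of the
  unprimed one, so its normalisation is a trigonometric equation of degree two; that equation is
  an identity only if the affine map is an isometry, which forces equal lengths.\<close>

lemma common_zeros:
  fixes x1 y1 x2 y2 x1' y1' x2' y2' k1 k2 :: real
  assumes nz: "\<not> (x1 = 0 \<and> y1 = 0)" and nz': "\<not> (x1' = 0 \<and> y1' = 0)"
    and len: "x1\<^sup>2 + y1\<^sup>2 \<noteq> x1'\<^sup>2 + y1'\<^sup>2"
    and indep: "\<not> (x1 * y2 = y1 * x2 \<and> x1' * y2' = y1' * x2')"
  shows "card_le {(s, t) \<in> full_turn \<times> full_turn.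
      x1 * cos s + y1 * sin s + k1 = x1' * cos t + y1' * sin t \<and>
      x2 * cos s + y2 * sin s + k2 = x2' * cos t + y2' * sin t} 4" (is "card_le ?Z 4")
proof (cases "x1' * y2' = y1' * x2'")
  case False
  define d where "d = x1' * y2' - y1' * x2'"
  have d: "d \<noteq> 0" using False by (simp add: d_def)
  \<comment> \<open>Cramer's rule: (cos t, sin t) = p + N (cos s, sin s) with the vector p = (p1,
    p2) and the matrix N with rows (n11, n12) and (n21, n22).\<close>
  define p1 n11 n12 where "p1 = (k1 * y2' - k2 * y1') / d"
    and "n11 = (x1 * y2' - x2 * y1') / d" and "n12 = (y1 * y2' - y2 * y1') / d"
  define p2 n21 n22 where "p2 = (k2 * x1' - k1 * x2') / d"
    and "n21 = (x2 * x1' - x1 * x2') / d" and "n22 = (y2 * x1' - y1 * x2') / d"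
  have dn: "d * p1 = k1 * y2' - k2 * y1'" "d * n11 = x1 * y2' - x2 * y1'"
    "d * n12 = y1 * y2' - y2 * y1'" "d * p2 = k2 * x1' - k1 * x2'"
    "d * n21 = x2 * x1' - x1 * x2'" "d * n22 = y2 * x1' - y1 * x2'"
    using d by (simp_all add: p1_def n11_def n12_def p2_def n21_def n22_def)
  have sol: "cos t = p1 + n11 * cos s + n12 * sin s \<and> sin t = p2 + n21 * cos s + n22 * sin s"
    if "(s, t) \<in> ?Z" for s t
  proof -
    have e: "x1 * cos s + y1 * sin s + k1 = x1' * cos t + y1' * sin t"
      "x2 * cos s + y2 * sin s + k2 = x2' * cos t + y2' * sin t" using that by auto
    have "d * cos t = y2' * (x1' * cos t + y1' * sin t) - y1' * (x2' * cos t + y2' * sin t)"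
      by (simp add: d_def algebra_simps)
    moreover have "d * sin t = x1' * (x2' * cos t + y2' * sin t) - x2' * (x1' * cos t + y1' * sin t)"
      by (simp add: d_def algebra_simps)
    ultimately have "d * cos t = d * (p1 + n11 * cos s + n12 * sin s)"
        "d * sin t = d * (p2 + n21 * cos s + n22 * sin s)"
      unfolding e[symmetric] distrib_left mult.assoc[symmetric] dn by algebra+
    then show ?thesis using d by simp
  qed
  \<comment> \<open>Fourier coefficients of |p + N (cos s, sin s)|^2 - 1, which vanishes at every
    common zero.\<close>
  define a0 where "a0 = p1\<^sup>2 + p2\<^sup>2 + (n11\<^sup>2 + n21\<^sup>2 + n12\<^sup>2 + n22\<^sup>2) / 2 - 1"
  define a1 b1 where "a1 = 2 * (p1 * n11 + p2 * n21)" and "b1 = 2 * (p1 * n12 + p2 * n22)"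
  define a2 b2 where "a2 = (n11\<^sup>2 + n21\<^sup>2 - n12\<^sup>2 - n22\<^sup>2) / 2" and "b2 = n11 * n12 + n21 * n22"
  have "\<not> (a0 = 0 \<and> a1 = 0 \<and> b1 = 0 \<and> a2 = 0 \<and> b2 = 0)"
  proof
    assume "a0 = 0 \<and> a1 = 0 \<and> b1 = 0 \<and> a2 = 0 \<and> b2 = 0"
    \<comment> \<open>The columns of N are orthogonal and equally long, and p is orthogonal to both
      of them.\<close>
    then have z: "p1\<^sup>2 + p2\<^sup>2 + (n11\<^sup>2 + n21\<^sup>2) = 1" "p1 * n11 + p2 * n21 = 0" "p1 * n12 + p2 * n22 = 0"
      "n11\<^sup>2 + n21\<^sup>2 = n12\<^sup>2 + n22\<^sup>2" "n11 * n12 + n21 * n22 = 0"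
      by (auto simp: a0_def a1_def b1_def a2_def b2_def field_simps)
    have "d * x1 = d * (x1' * n11 + y1' * n21)" "d * y1 = d * (x1' * n12 + y1' * n22)"
      using dn(2,3,5,6) d_def by algebra+
    then have x: "x1 = x1' * n11 + y1' * n21" and y: "y1 = x1' * n12 + y1' * n22"
      using d by simp_all
    \<comment> \<open>\<open>L\<close> is the squared length of the columns and \<open>D\<close> the
      determinant of N; by Lagrange's identity they agree up to sign. If \<open>L\<close> were 0,
      then N = 0 and (x1, y1), the image of (x1', y1') under the transpose of N, would vanish. So p
      = 0, hence \<open>L\<close> = 1 and N is an isometry.\<close>
    define L where "L = n11\<^sup>2 + n21\<^sup>2"
    define D where "D = n11 * n22 - n12 * n21"
    have "L * L = (n11\<^sup>2 + n21\<^sup>2) * (n12\<^sup>2 + n22\<^sup>2)" using z(4) by (simp add: L_def)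
    also have "\<dots> = D\<^sup>2 + (n11 * n12 + n21 * n22)\<^sup>2"
      by (simp add: D_def power2_eq_square algebra_simps)
    finally have Lsq: "L\<^sup>2 = D\<^sup>2" using z(5) by (simp add: power2_eq_square)
    have "L * p1 = 0" "L * p2 = 0"
    proof -
      have "D * p1 = n22 * (p1 * n11 + p2 * n21) - n21 * (p1 * n12 + p2 * n22)"
        "D * p2 = n11 * (p1 * n12 + p2 * n22) - n12 * (p1 * n11 + p2 * n21)"
        by (simp_all add: D_def algebra_simps)
      then have "D * p1 = 0" "D * p2 = 0" using z(2,3) by simp_all
      then show "L * p1 = 0" "L * p2 = 0" using Lsq by auto
    qed
    moreover have "L \<noteq> 0"
    proof
      assume "L = 0"
      then have "n11 = 0" "n21 = 0" "n12 = 0" "n22 = 0"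
        using z(4) by (simp_all add: L_def sum_power2_eq_zero_iff)
      then show False using nz x y by simp
    qed
    ultimately have "p1 = 0" "p2 = 0" by simp_all
    then have "L = 1" using z(1) by (simp add: L_def)
    then have l: "n11\<^sup>2 + n21\<^sup>2 = 1" "n12\<^sup>2 + n22\<^sup>2 = 1" using z(4) by (auto simp: L_def)
    have "D * n11 = n22 * (n11\<^sup>2 + n21\<^sup>2) - n21 * (n11 * n12 + n21 * n22)"
      "D * n21 = n11 * (n11 * n12 + n21 * n22) - n12 * (n11\<^sup>2 + n21\<^sup>2)"
      by (simp_all add: D_def power2_eq_square algebra_simps)
    then have n: "n22 = D * n11" "n12 = - (D * n21)" using l(1) z(5) by simp_all
    have D: "D\<^sup>2 = 1" using Lsq \<open>L = 1\<close> by simp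
    have "x1\<^sup>2 + y1\<^sup>2 = (x1' * n11 + y1' * n21)\<^sup>2 + D\<^sup>2 * (y1' * n11 - x1' * n21)\<^sup>2"
      unfolding x y n by (simp add: power2_eq_square algebra_simps)
    also have "\<dots> = (x1'\<^sup>2 + y1'\<^sup>2) * (n11\<^sup>2 + n21\<^sup>2)"
      unfolding D by (simp add: power2_eq_square algebra_simps)
    also have "\<dots> = x1'\<^sup>2 + y1'\<^sup>2" using l(1) by simp
    finally have "x1\<^sup>2 + y1\<^sup>2 = x1'\<^sup>2 + y1'\<^sup>2" .
    then show False using len by simp
  qed
  note few = trig_poly2_zeros[OF this]
  show ?thesis
  proof (rule card_le_inj_on[OF few, of fst])
    show "inj_on fst ?Z"
    proof (rule inj_onI)
      fix z w assume zw: "z \<in> ?Z" "w \<in> ?Z" "fst z = fst w"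
      obtain s t t' where e: "z = (s, t)" "w = (s, t')" using zw by (metis prod.collapse)
      have "cis t = cis t'"
        using sol[of s t] sol[of s t'] zw e by (simp add: complex_eq_iff)
      then show "z = w" using zw e inj_onD[OF inj_on_cis] by auto
    qed
    show "fst ` ?Z \<subseteq> {s \<in> full_turn. a0 + a1 * cos s + b1 * sin s + a2 * cos (2 * s) + b2 * sin (2 * s) = 0}"
    proof (clarsimp simp del: mult_eq_0_iff)
      fix s t assume st: "0 \<le> s" "s < 2 * pi" "0 \<le> t" "t < 2 * pi"
        "x1 * cos s + y1 * sin s + k1 = x1' * cos t + y1' * sin t"
        "x2 * cos s + y2 * sin s + k2 = x2' * cos t + y2' * sin t"
      have "(p1 + n11 * cos s + n12 * sin s)\<^sup>2 + (p2 + n21 * cos s + n22 * sin s)\<^sup>2 = 1"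
        using sol[of s t] st sin_cos_squared_add[of t] by auto
      moreover have "a0 + a1 * cos s + b1 * sin s + a2 * cos (2 * s) + b2 * sin (2 * s)
          = (p1 + n11 * cos s + n12 * sin s)\<^sup>2 + (p2 + n21 * cos s + n22 * sin s)\<^sup>2 - 1"
      proof -
        have "p1\<^sup>2 + p2\<^sup>2 + (n11\<^sup>2 + n21\<^sup>2 + n12\<^sup>2 + n22\<^sup>2) / 2 * (y\<^sup>2 + x\<^sup>2) - 1
            + 2 * (p1 * n11 + p2 * n21) * x + 2 * (p1 * n12 + p2 * n22) * y
            + (n11\<^sup>2 + n21\<^sup>2 - n12\<^sup>2 - n22\<^sup>2) / 2 * (x\<^sup>2 - y\<^sup>2) + (n11 * n12 + n21 * n22) * (2 * y * x)
          = (p1 + n11 * x + n12 * y)\<^sup>2 + (p2 + n21 * x + n22 * y)\<^sup>2 - 1" for x y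
          by (simp add: power2_eq_square field_simps)
        from this[of "sin s" "cos s"] show ?thesis
          unfolding cos_double sin_double a0_def a1_def b1_def a2_def b2_def by simp
      qed
      ultimately show "a0 + a1 * cos s + b1 * sin s + a2 * cos (2 * s) + b2 * sin (2 * s) = 0"
        by simp
    qed
  qed
next
  case True
  then have ind: "x1 * y2 \<noteq> y1 * x2" using indep by auto
  obtain \<tau> where tau: "x2' = \<tau> * x1'" "y2' = \<tau> * y1'"
  proof (cases "x1' = 0")
    case xz: True
    then show ?thesis using that[of "y2' / y1'"] nz' True by simp
  next
    case False
    then show ?thesis using that[of "x2' / x1'"] True by (simp add: field_simps)
  qed
  \<comment> \<open>Subtracting \<tau> times the first equation from the second eliminates t. The
    remaining equation of degree one in s is nontrivial because the rows (x1, y1) and (x2, y2) are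
    independent; each of its at most two solutions s leaves at most two values of t.\<close>
  let ?S = "{s \<in> full_turn. (k2 - \<tau> * k1) + (x2 - \<tau> * x1) * cos s + (y2 - \<tau> * y1) * sin s = 0}"
  have s: "card_le ?S 2" using ind by (intro trig_poly1_zeros) auto
  have t: "card_le {t \<in> full_turn. x1 * cos s + y1 * sin s + k1 = x1' * cos t + y1' * sin t} 2" for s
    by (rule card_le_subset[OF trig_poly1_zeros[of "- (x1 * cos s + y1 * sin s + k1)" x1' y1']])
      (use nz' in auto)
  have "card_le (SIGMA s : ?S.
      {t \<in> full_turn. x1 * cos s + y1 * sin s + k1 = x1' * cos t + y1' * sin t}) (2 * 2)"
    by (rule card_le_Sigma[OF s t])
  then have "card_le (SIGMA s : ?S.
      {t \<in> full_turn. x1 * cos s + y1 * sin s + k1 = x1' * cos t + y1' * sin t}) 4"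
    by simp
  then show ?thesis
  proof (rule card_le_subset)
    show "?Z \<subseteq> (SIGMA s : ?S.
      {t \<in> full_turn. x1 * cos s + y1 * sin s + k1 = x1' * cos t + y1' * sin t})"
    proof
      fix z assume "z \<in> ?Z"
      then obtain s t where z: "z = (s, t)" and st: "s \<in> full_turn" "t \<in> full_turn"
        and e1: "x1 * cos s + y1 * sin s + k1 = x1' * cos t + y1' * sin t"
        and e2: "x2 * cos s + y2 * sin s + k2 = x2' * cos t + y2' * sin t"
        by auto
      have "x2 * cos s + y2 * sin s + k2 = \<tau> * (x1 * cos s + y1 * sin s + k1)"
        unfolding e1 e2 tau by (simp add: algebra_simps)
      then have "(k2 - \<tau> * k1) + (x2 - \<tau> * x1) * cos s + (y2 - \<tau> * y1) * sin s = 0"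
        by (simp add: algebra_simps)
      then show "z \<in> (SIGMA s : ?S.
          {t \<in> full_turn. x1 * cos s + y1 * sin s + k1 = x1' * cos t + y1' * sin t})"
        using z st e1 by simp
    qed
  qed
qed

section \<open>Incidences with a grid\<close>

text \<open>The second factor is the sum of the squared fibre sizes of \<open>f\<close>, so this is
  the Cauchy-Schwarz inequality.\<close>

lemma card_energy_ge:
  assumes "finite A"
  shows "(card A)\<^sup>2 \<le> card (f ` A) * card {(x, y) \<in> A \<times> A. f x = f y}"
proof -
  define N where "N d = card {x \<in> A. f x = d}" for d
  have A: "card A = (\<Sum>d\<in>f ` A. N d)"
  proof -
    have "card A = card (\<Union>d\<in>f ` A. {x \<in> A. f x = d})" by (rule arg_cong[of _ _ card]) auto
    also have "\<dots> = (\<Sum>d\<in>f ` A. N d)"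
      unfolding N_def using assms by (subst card_UN_disjoint) auto
    finally show ?thesis .
  qed
  have "{(x, y) \<in> A \<times> A. f x = f y} = (SIGMA x : A. {y \<in> A. f y = f x})" by auto
  then have "card {(x, y) \<in> A \<times> A. f x = f y} = (\<Sum>x\<in>A. N (f x))"
    unfolding N_def using assms by simp
  also have "\<dots> = (\<Sum>d\<in>f ` A. of_nat (card {x \<in> A. f x = d}) * N d)"
    using assms by (intro sum_fun_comp) auto
  finally have Q: "card {(x, y) \<in> A \<times> A. f x = f y} = (\<Sum>d\<in>f ` A. (N d)\<^sup>2)"
    by (simp add: N_def power2_eq_square)
  have "(real (card A))\<^sup>2 \<le> real (card (f ` A)) * (\<Sum>d\<in>f ` A. (real (N d))\<^sup>2)"
    using sum_squared_le_sum_of_squares[of "\<lambda>d. real (N d)" "f ` A"] assms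
    by (simp add: A mult.commute)
  then have "real ((card A)\<^sup>2) \<le> real (card (f ` A) * (\<Sum>d\<in>f ` A. (N d)\<^sup>2))" by simp
  then show ?thesis unfolding Q of_nat_le_iff .
qed

text \<open>Within a cell, fix one incident point \<open>v\<close>: every other incident point is either bad for \<open>v\<close>
  or forms with \<open>v\<close> a good pair, and good pairs are rarely shared between curves.\<close>

lemma incidence_bound:
  fixes inc :: "'u \<Rightarrow> 'v \<Rightarrow> bool" and cell :: "'v \<Rightarrow> 'c"
  assumes fin: "finite U" "finite V"
    and cells: "\<And>u. u \<in> U \<Longrightarrow> card (cell ` {v \<in> V. inc u v}) \<le> p"
    and bad: "\<And>v. v \<in> V \<Longrightarrow> card {w \<in> V. bad v w} \<le> k"
    and good: "\<And>v w. v \<in> V \<Longrightarrow> w \<in> V \<Longrightarrow> \<not> bad v w \<Longrightarrow> card {u \<in> U. inc u v \<and> inc u w} \<le> l"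
    and size: "\<And>v. v \<in> V \<Longrightarrow> card {w \<in> V. cell w = cell v} \<le> q"
  shows "card {(u, v) \<in> U \<times> V. inc u v} \<le> k * p * card U + l * q * card V"
proof -
  define I where "I u = {v \<in> V. inc u v}" for u
  define W where "W = {(v, w) \<in> V \<times> V. cell w = cell v \<and> \<not> bad v w}"
  define G where "G u = {z \<in> W. inc u (fst z) \<and> inc u (snd z)}" for u
  have finW: "finite W" unfolding W_def by (rule finite_subset[of _ "V \<times> V"]) (use fin in auto)
  have finG: "finite (G u)" for u unfolding G_def using finW by simp
  have I: "card (I u) \<le> k * p + card (G u)" if u: "u \<in> U" for u
  proof -
    have "\<forall>c\<in>cell ` I u. \<exists>v\<in>I u. cell v = c" by auto
    then obtain rep where rep: "\<And>c. c \<in> cell ` I u \<Longrightarrow> rep c \<in> I u \<and> cell (rep c) = c" by metis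
    have "I u \<subseteq> (\<Union>c\<in>cell ` I u. {w \<in> V. bad (rep c) w}) \<union> snd ` G u"
    proof
      fix w assume w: "w \<in> I u"
      let ?v = "rep (cell w)"
      have v: "?v \<in> I u" "cell ?v = cell w" using rep w by auto
      show "w \<in> (\<Union>c\<in>cell ` I u. {w \<in> V. bad (rep c) w}) \<union> snd ` G u"
      proof (cases "bad ?v w")
        case True
        then show ?thesis using w by (auto simp: I_def)
      next
        case False
        then have "(?v, w) \<in> G u" using v w by (auto simp: G_def W_def I_def)
        then show ?thesis by force
      qed
    qed
    moreover have finI: "finite (cell ` I u)" using fin by (simp add: I_def)
    moreover have "finite (\<Union>c\<in>cell ` I u. {w \<in> V. bad (rep c) w})"
      using fin by (intro finite_UN_I finI) simp
    ultimately have "card (I u) \<le> card ((\<Union>c\<in>cell ` I u. {w \<in> V. bad (rep c) w}) \<union> snd ` G u)"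
      using finG by (intro card_mono) auto
    also have "\<dots> \<le> card (\<Union>c\<in>cell ` I u. {w \<in> V. bad (rep c) w}) + card (snd ` G u)"
      by (rule card_Un_le)
    also have "card (\<Union>c\<in>cell ` I u. {w \<in> V. bad (rep c) w}) \<le> (\<Sum>c\<in>cell ` I u. k)"
      using finI rep bad by (intro order_trans[OF card_UN_le] sum_mono) (auto simp: I_def)
    also have "(\<Sum>c\<in>cell ` I u. k) \<le> k * p" using cells[OF u] by (simp add: I_def mult.commute)
    also have "card (snd ` G u) \<le> card (G u)" by (rule card_image_le[OF finG])
    finally show ?thesis by simp
  qed
  have W: "card W \<le> q * card V"
  proof -
    have "card W \<le> card (SIGMA v : V. {w \<in> V. cell w = cell v})"
      by (rule card_mono) (use fin in \<open>auto simp: W_def\<close>)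
    also have "\<dots> = (\<Sum>v\<in>V. card {w \<in> V. cell w = cell v})" using fin by simp
    also have "\<dots> \<le> (\<Sum>v\<in>V. q)" using size by (intro sum_mono) auto
    finally show ?thesis by (simp add: mult.commute)
  qed
  \<comment> \<open>Double counting: each pair in \<open>W\<close> is good, hence incident to at
    most \<open>l\<close> elements of \<open>U\<close>.\<close>
  have "(\<Sum>u\<in>U. card (G u)) = (\<Sum>u\<in>U. \<Sum>z\<in>W. if inc u (fst z) \<and> inc u (snd z) then 1 else 0)"
    unfolding G_def using finW by (simp add: sum.If_cases Int_def)
  also have "\<dots> = (\<Sum>z\<in>W. card {u \<in> U. inc u (fst z) \<and> inc u (snd z)})"
    using fin by (subst sum.swap) (simp add: sum.If_cases Int_def)
  also have "\<dots> \<le> (\<Sum>z\<in>W. l)"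
    using good by (intro sum_mono) (auto simp: W_def)
  also have "\<dots> \<le> l * q * card V" using W by (simp add: mult.commute mult.left_commute)
  finally have G: "(\<Sum>u\<in>U. card (G u)) \<le> l * q * card V" .
  have "{(u, v) \<in> U \<times> V. inc u v} = (SIGMA u : U. I u)" by (auto simp: I_def)
  then have "card {(u, v) \<in> U \<times> V. inc u v} = (\<Sum>u\<in>U. card (I u))"
    using fin by (simp add: I_def)
  also have "\<dots> \<le> (\<Sum>u\<in>U. k * p + card (G u))" by (rule sum_mono[OF I])
  also have "\<dots> = k * p * card U + (\<Sum>u\<in>U. card (G u))" by (simp add: sum.distrib mult.commute)
  finally show ?thesis using G by linarith
qed

text \<open>Sorted by rank, \<open>Y\<close> is cut into runs of \<open>s\<close> consecutive
  elements. A last, shorter run accounts for the summand \<open>s\<close> in the bound on the number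
  of runs. Monotonicity of \<kappa> makes the runs span disjoint intervals.\<close>

lemma ex_blocks:
  fixes Y :: "'a::linorder set"
  assumes fin: "finite Y" and s: "s \<ge> 1"
  obtains \<kappa> :: "'a \<Rightarrow> nat" where "mono_on Y \<kappa>" "\<And>i. card {y \<in> Y. \<kappa> y = i} \<le> s"
    "s * card (\<kappa> ` Y) \<le> card Y + s"
proof
  define rank where "rank y = card {z \<in> Y. z < y}" for y
  define \<kappa> where "\<kappa> y = rank y div s" for y
  have less: "rank x < rank y" if "x \<in> Y" "x < y" for x y
    unfolding rank_def by (rule psubset_card_mono) (use fin that in auto)
  have inj: "inj_on rank Y"
    by (rule inj_onI) (metis less linorder_neqE order_less_irrefl)
  show "mono_on Y \<kappa>"
    unfolding \<kappa>_def by (rule mono_onI) (metis div_le_mono less order_le_less)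
  show "card {y \<in> Y. \<kappa> y = i} \<le> s" for i
  proof -
    have "card {y \<in> Y. \<kappa> y = i} = card (rank ` {y \<in> Y. \<kappa> y = i})"
      by (rule card_image[symmetric], rule inj_on_subset[OF inj]) auto
    also have "\<dots> \<le> card {i * s..<i * s + s}"
    proof (rule card_mono)
      show "rank ` {y \<in> Y. \<kappa> y = i} \<subseteq> {i * s..<i * s + s}"
        using s by (auto simp: \<kappa>_def dividend_less_div_times add.commute)
    qed simp
    finally show ?thesis by simp
  qed
  show "s * card (\<kappa> ` Y) \<le> card Y + s"
  proof (cases "Y = {}")
    case False
    have "rank y < card Y" if "y \<in> Y" for y
      unfolding rank_def by (rule psubset_card_mono) (use fin that in auto)
    then have "\<kappa> ` Y \<subseteq> {..card Y div s}" by (auto simp: \<kappa>_def intro: div_le_mono less_imp_le)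
    then have "card (\<kappa> ` Y) \<le> card Y div s + 1"
      using card_mono[of "{..card Y div s}"] by simp
    then have "s * card (\<kappa> ` Y) \<le> s * (card Y div s) + s"
      by (metis mult.right_neutral mult_le_mono2 distrib_left)
    also have "\<dots> \<le> card Y + s" by simp
    finally show ?thesis .
  qed simp
qed

text \<open>Two finite families of intervals in which no point is covered more than twice have few
  intersecting pairs: in each such pair, the lower endpoint of one interval lies in the other one.
  Here the intervals are the images of the blocks under \<open>g\<close> and \<open>h\<close>.\<close>

lemma few_cells:
  fixes g h :: "real \<Rightarrow> real" and \<kappa> :: "real \<Rightarrow> nat"
  assumes cont: "continuous_on UNIV g" "continuous_on UNIV h"
    and Y: "finite Y" "Y \<subseteq> full_turn" and mono: "mono_on Y \<kappa>"
    and g: "\<And>v. card_le {x \<in> full_turn. g x = v} 2"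
    and h: "\<And>v. card_le {x \<in> full_turn. h x = v} 2"
  shows "card {(\<kappa> b, \<kappa> b') | b b'. b \<in> Y \<and> b' \<in> Y \<and> g b = h b'} \<le> 4 * card (\<kappa> ` Y)"
proof -
  define B where "B i = {y \<in> Y. \<kappa> y = i}" for i
  define J where "J i = {Min (B i)..Max (B i)}" for i
  have B: "finite (B i)" for i using Y by (simp add: B_def)
  have Bne: "B i \<noteq> {}" if "i \<in> \<kappa> ` Y" for i using that by (auto simp: B_def)
  have mm: "Min (B i) \<in> Y" "\<kappa> (Min (B i)) = i" "Max (B i) \<in> Y" "\<kappa> (Max (B i)) = i"
    if "i \<in> \<kappa> ` Y" for i
    using Min_in[OF B Bne[OF that]] Max_in[OF B Bne[OF that]] by (auto simp: B_def)
  have in_J: "y \<in> J (\<kappa> y)" if "y \<in> Y" for y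
    unfolding J_def using B that by (auto simp: B_def)
  have J_sub: "J i \<subseteq> full_turn" if "i \<in> \<kappa> ` Y" for i
    using mm[OF that] Y by (fastforce simp: J_def)
  \<comment> \<open>Applied in both orders, this makes the hulls \<open>J i\<close> of different
    blocks disjoint.\<close>
  have J_le: "j \<le> i" if "i \<in> \<kappa> ` Y" "j \<in> \<kappa> ` Y" "x \<in> J i" "x \<in> J j" for i j x
  proof -
    have "Min (B j) \<le> Max (B i)" using that by (auto simp: J_def)
    then have "\<kappa> (Min (B j)) \<le> \<kappa> (Max (B i))"
      using mono_onD[OF mono mm(1)[OF that(2)] mm(3)[OF that(1)]] by simp
    then show ?thesis using mm(2)[OF that(2)] mm(4)[OF that(1)] by simp
  qed
  \<comment> \<open>Disjoint hulls need different preimages of the value, and there are at most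
    two.\<close>
  have hit: "card_le {i \<in> \<kappa> ` Y. \<exists>x\<in>J i. f x = v} 2"
    if f: "card_le {x \<in> full_turn. f x = v} 2" for f :: "real \<Rightarrow> real" and v
  proof -
    have "\<forall>i\<in>{i \<in> \<kappa> ` Y. \<exists>x\<in>J i. f x = v}. \<exists>x. x \<in> J i \<and> f x = v" by blast
    from bchoice[OF this] obtain x
      where x: "\<And>i. i \<in> {i \<in> \<kappa> ` Y. \<exists>x\<in>J i. f x = v} \<Longrightarrow> x i \<in> J i \<and> f (x i) = v"
      by blast
    show ?thesis
    proof (rule card_le_inj_on[OF f])
      show "inj_on x {i \<in> \<kappa> ` Y. \<exists>x\<in>J i. f x = v}"
      proof (rule inj_onI)
        fix i j assume ij: "i \<in> {i \<in> \<kappa> ` Y. \<exists>x\<in>J i. f x = v}"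
          "j \<in> {i \<in> \<kappa> ` Y. \<exists>x\<in>J i. f x = v}" "x i = x j"
        then have "x i \<in> J i" "x i \<in> J j" using x[OF ij(1)] x[OF ij(2)] by auto
        then show "i = j" using ij(1,2) J_le[of i j "x i"] J_le[of j i "x i"] by auto
      qed
      show "x ` {i \<in> \<kappa> ` Y. \<exists>x\<in>J i. f x = v} \<subseteq> {x \<in> full_turn. f x = v}"
      proof (rule image_subsetI)
        fix i assume i: "i \<in> {i \<in> \<kappa> ` Y. \<exists>x\<in>J i. f x = v}"
        then have "J i \<subseteq> full_turn" by (intro J_sub) simp
        then show "x i \<in> {x \<in> full_turn. f x = v}" using x[OF i] by blast
      qed
    qed
  qed
  have inf: "\<exists>m. \<forall>i\<in>\<kappa> ` Y. m i \<in> J i \<and> (\<forall>y\<in>J i. f (m i) \<le> f y)"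
    if f: "continuous_on UNIV f" for f :: "real \<Rightarrow> real"
  proof -
    have "\<forall>i\<in>\<kappa> ` Y. \<exists>x. x \<in> J i \<and> (\<forall>y\<in>J i. f x \<le> f y)"
    proof
      fix i assume "i \<in> \<kappa> ` Y"
      then have "J i \<noteq> {}" using in_J by auto
      moreover have "compact (J i)" by (simp add: J_def)
      moreover have "continuous_on (J i) f" using f continuous_on_subset by blast
      ultimately show "\<exists>x. x \<in> J i \<and> (\<forall>y\<in>J i. f x \<le> f y)"
        using continuous_attains_inf[of "J i" f] by blast
    qed
    then show ?thesis by (rule bchoice)
  qed
  have ivt: "\<exists>z\<in>J i. f z = v"
    if f: "continuous_on UNIV f" and xy: "x \<in> J i" "y \<in> J i" "f x \<le> v" "v \<le> f y"
    for f :: "real \<Rightarrow> real" and v x y i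
  proof -
    have "connected (f ` J i)"
      using f continuous_on_subset by (intro connected_continuous_image) (auto simp: J_def)
    then have "{f x..f y} \<subseteq> f ` J i" using xy by (intro connected_contains_Icc) auto
    moreover have "v \<in> {f x..f y}" using xy by simp
    ultimately have "v \<in> f ` J i" by (rule subsetD)
    then show ?thesis by blast
  qed
  from inf[OF cont(1)] obtain mg
    where mg: "\<forall>i\<in>\<kappa> ` Y. mg i \<in> J i \<and> (\<forall>y\<in>J i. g (mg i) \<le> g y)" ..
  from inf[OF cont(2)] obtain mh
    where mh: "\<forall>i\<in>\<kappa> ` Y. mh i \<in> J i \<and> (\<forall>y\<in>J i. h (mh i) \<le> h y)" ..
  let ?r = "card (\<kappa> ` Y)"
  \<comment> \<open>\<open>S\<close> consists of the block pairs in which the minimum of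
    \<open>g\<close> over the first hull is a value of \<open>h\<close> on the second.
    \<open>T\<close> exchanges the roles of \<open>g\<close> and \<open>h\<close>, so its pairs
    appear in reverse order.\<close>
  define S where "S = (SIGMA i : \<kappa> ` Y. {j \<in> \<kappa> ` Y. \<exists>x\<in>J j. h x = g (mg i)})"
  define T where "T = (SIGMA j : \<kappa> ` Y. {i \<in> \<kappa> ` Y. \<exists>x\<in>J i. g x = h (mh j)})"
  have r: "card_le (\<kappa> ` Y) ?r" using Y by (simp add: card_le_def)
  have S: "card_le S (?r * 2)" unfolding S_def by (rule card_le_Sigma[OF r hit[OF h]])
  have "card_le T (?r * 2)" unfolding T_def by (rule card_le_Sigma[OF r hit[OF g]])
  then have T: "card_le (prod.swap ` T) (?r * 2)"
    by (auto simp: card_le_def card_image)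
  have "{(\<kappa> b, \<kappa> b') | b b'. b \<in> Y \<and> b' \<in> Y \<and> g b = h b'} \<subseteq> S \<union> prod.swap ` T"
  proof clarify
    fix b b' assume b: "b \<in> Y" "b' \<in> Y" "g b = h b'" "(\<kappa> b, \<kappa> b') \<notin> prod.swap ` T"
    have J: "b \<in> J (\<kappa> b)" "b' \<in> J (\<kappa> b')" using in_J b by auto
    have "\<kappa> b \<in> \<kappa> ` Y" "\<kappa> b' \<in> \<kappa> ` Y" using b by auto
    from bspec[OF mg this(1)] bspec[OF mh this(2)] J
    have m: "g (mg (\<kappa> b)) \<le> g b" "h (mh (\<kappa> b')) \<le> h b'" "mg (\<kappa> b) \<in> J (\<kappa> b)" "mh (\<kappa> b') \<in> J (\<kappa> b')"
      by blast+
    \<comment> \<open>Both minima are at most the common value g b = h b'. Hence the larger minimum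
      is attained by the other function on its hull, by the intermediate value theorem.\<close>
    have "\<not> g (mg (\<kappa> b)) \<le> h (mh (\<kappa> b'))"
    proof
      assume "g (mg (\<kappa> b)) \<le> h (mh (\<kappa> b'))"
      then have "\<exists>z\<in>J (\<kappa> b). g z = h (mh (\<kappa> b'))"
        using m J b(3) by (intro ivt[OF cont(1), of "mg (\<kappa> b)" _ b]) simp_all
      then have "(\<kappa> b', \<kappa> b) \<in> T" using b by (auto simp: T_def)
      then show False using b(4) by (force simp: image_iff)
    qed
    then have "\<exists>z\<in>J (\<kappa> b'). h z = g (mg (\<kappa> b))"
      using m J b(3) by (intro ivt[OF cont(2), of "mh (\<kappa> b')" _ b']) simp_all
    then show "(\<kappa> b, \<kappa> b') \<in> S" using b by (auto simp: S_def)
  qed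
  then show ?thesis
    using card_le_subset[OF card_le_Un[OF S T]] by (simp add: card_le_def)
qed

section \<open>The energy of a trigonometric form\<close>

definition trig_form :: "real \<Rightarrow> real \<Rightarrow> real \<Rightarrow> real \<Rightarrow> real \<Rightarrow> real \<Rightarrow> real \<Rightarrow> real" where
  "trig_form l A B C E s t =
     cos s * cos t + l * sin s * sin t + A * cos s + B * sin s + C * cos t + E * sin t"

lemma trig_form_swap: "trig_form l A B C E s t = trig_form l C E A B t s"
  by (simp add: trig_form_def)

text \<open>As t varies, the coefficient vector of (cos s, sin s) traces a possibly degenerate
  ellipse with centre (A, B); lengths and directions of this vector govern all exceptional
  cases.\<close>

lemma trig_form_left:
  "trig_form l A B C E s t = (A + cos t) * cos s + (B + l * sin t) * sin s + (C * cos t + E * sin t)"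
  by (simp add: trig_form_def algebra_simps)

lemma continuous_trig_form: "continuous_on S (trig_form l A B C E s)"
  unfolding trig_form_def by (intro continuous_intros)

lemma trig_form_fibre:
  assumes "\<not> (A + cos t = 0 \<and> B + l * sin t = 0)"
  shows "card_le {s \<in> full_turn. trig_form l A B C E s t = v} 2"
  by (rule card_le_subset[OF trig_poly1_zeros[of "C * cos t + E * sin t - v" "A + cos t" "B + l * sin t"]])
    (use assms in \<open>auto simp: trig_form_left\<close>)

text \<open>The squared length of the ellipse point is a trigonometric polynomial of degree two. It
  is constant only if the ellipse is a unit circle about the origin, which the hypothesis
  excludes.\<close>

lemma ellipse_circle_inter:
  assumes "\<not> (l\<^sup>2 = 1 \<and> A = 0 \<and> B = 0)"
  shows "card_le {t \<in> full_turn. (A + cos t)\<^sup>2 + (B + l * sin t)\<^sup>2 = v} 4"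
proof -
  have "(A + cos t)\<^sup>2 + (B + l * sin t)\<^sup>2 - v = (A\<^sup>2 + B\<^sup>2 - v + (1 + l\<^sup>2) / 2)
      + 2 * A * cos t + 2 * B * l * sin t + (1 - l\<^sup>2) / 2 * cos (2 * t) + 0 * sin (2 * t)" for t
  proof -
    have "(A + cos t)\<^sup>2 + (B + l * sin t)\<^sup>2
        = A\<^sup>2 + B\<^sup>2 + 2 * A * cos t + 2 * B * l * sin t + (cos t)\<^sup>2 + l\<^sup>2 * (sin t)\<^sup>2"
      by (simp add: power2_eq_square algebra_simps)
    moreover have "(cos t)\<^sup>2 = (1 + cos (2 * t)) / 2" by (simp add: cos_double_cos)
    moreover have "(sin t)\<^sup>2 = (1 - cos (2 * t)) / 2" by (simp add: cos_double_sin)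
    ultimately show ?thesis by (simp add: field_simps)
  qed
  then have "{t \<in> full_turn. (A + cos t)\<^sup>2 + (B + l * sin t)\<^sup>2 = v} \<subseteq>
      {t \<in> full_turn. (A\<^sup>2 + B\<^sup>2 - v + (1 + l\<^sup>2) / 2)
      + 2 * A * cos t + 2 * B * l * sin t + (1 - l\<^sup>2) / 2 * cos (2 * t) + 0 * sin (2 * t) = 0}"
    by (auto simp: algebra_simps)
  moreover have "\<not> (A\<^sup>2 + B\<^sup>2 - v + (1 + l\<^sup>2) / 2 = 0 \<and> 2 * A = 0 \<and> 2 * B * l = 0 \<and> (1 - l\<^sup>2) / 2 = 0 \<and> (0::real) = 0)"
    using assms by auto
  ultimately show ?thesis using trig_poly2_zeros card_le_subset by blast
qed

text \<open>A line through the origin meets the ellipse at most twice unless it contains it; the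
  second hypothesis excludes an ellipse flattened onto the first coordinate axis.\<close>

lemma ellipse_line_inter:
  assumes "\<not> (x = 0 \<and> y = 0)" and "l \<noteq> 0 \<or> B \<noteq> 0"
  shows "card_le {t \<in> full_turn. x * (B + l * sin t) = y * (A + cos t)} 2"
  by (rule card_le_subset[OF trig_poly1_zeros[of "x * B - y * A" "- y" "x * l"]])
    (use assms in \<open>auto simp: algebra_simps\<close>)

text \<open>Here \<open>r\<close> is the number of blocks of \<open>Y\<close>, of length at most
  \<open>s\<close>. The first summand counts solutions in which b and b' have vectors of equal
  length. The other two come from \<open>incidence_bound\<close>: at most 4 bad partners in each of
  at most 4r cells per curve, and at most 4 curves through each good pair, with at most s^2 grid
  points per cell.\<close>

lemma trig_form_energy:
  fixes l A B C E :: real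
  defines "f \<equiv> trig_form l A B C E"
  assumes X: "finite X" "X \<subseteq> full_turn" and Y: "finite Y" "Y \<subseteq> full_turn"
    and ndX: "\<And>a. a \<in> X \<Longrightarrow> \<not> (C + cos a = 0 \<and> E + l * sin a = 0)"
    and ndY: "\<And>b. b \<in> Y \<Longrightarrow> \<not> (A + cos b = 0 \<and> B + l * sin b = 0)"
    and lB: "l \<noteq> 0 \<or> B \<noteq> 0" and lAB: "\<not> (l\<^sup>2 = 1 \<and> A = 0 \<and> B = 0)" and s: "s \<ge> 1"
  obtains r where "s * r \<le> card Y + s"
    "card {((a, b), (a', b')). (a, b) \<in> X \<times> Y \<and> (a', b') \<in> X \<times> Y \<and> f a b = f a' b'}
      \<le> 8 * card X * card Y + 16 * r * (card X)\<^sup>2 + 4 * s\<^sup>2 * (card Y)\<^sup>2"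
proof -
  obtain \<kappa> :: "real \<Rightarrow> nat" where mono: "mono_on Y \<kappa>" and blk: "\<And>i. card {y \<in> Y. \<kappa> y = i} \<le> s"
    and r: "s * card (\<kappa> ` Y) \<le> card Y + s"
    using ex_blocks[OF Y(1) s] by metis
  let ?r = "card (\<kappa> ` Y)"
  define px py where "px b = A + cos b" and "py b = B + l * sin b" for b
  \<comment> \<open>These grid points are counted separately, since \<open>common_zeros\<close>
    requires different lengths.\<close>
  define S where "S = {(b, b') \<in> Y \<times> Y. (px b)\<^sup>2 + (py b)\<^sup>2 = (px b')\<^sup>2 + (py b')\<^sup>2}"
  define V where "V = Y \<times> Y - S"
  \<comment> \<open>The pair u = (a, a') indexes the curve f a b = f a' b' in the plane of (b, b');
    \<open>few_cells\<close> applies to it with f a and f a' as the two functions.\<close>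
  define inc where "inc u v \<longleftrightarrow> f (fst u) (fst v) = f (snd u) (snd v)" for u v
  define bad where "bad v w \<longleftrightarrow> px (fst v) * py (fst w) = py (fst v) * px (fst w) \<and>
      px (snd v) * py (snd w) = py (snd v) * px (snd w)" for v w
  define cell where "cell v = (\<kappa> (fst v), \<kappa> (snd v))" for v
  have finV: "finite V" using Y by (simp add: V_def)
  have f_left: "f a b = px b * cos a + py b * sin a + (C * cos b + E * sin b)" for a b
    by (simp add: f_def px_def py_def trig_form_left)
  have fib_a: "card_le {a \<in> full_turn. f a b = v} 2" if "b \<in> Y" for b v
    unfolding f_def by (rule trig_form_fibre[OF ndY[OF that]])
  have fib_b: "card_le {b \<in> full_turn. f a b = v} 2" if "a \<in> X" for a v
    unfolding f_def by (subst trig_form_swap) (rule trig_form_fibre[OF ndX[OF that]])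
  have "card {(u, v) \<in> (X \<times> X) \<times> V. inc u v} \<le> 4 * (4 * ?r) * card (X \<times> X) + 4 * (s * s) * card V"
  proof (rule incidence_bound[where bad = bad and cell = cell])
    show "finite (X \<times> X)" "finite V" using X finV by auto
  next
    fix u assume u: "u \<in> X \<times> X"
    have "cell ` {v \<in> V. inc u v} \<subseteq>
        {(\<kappa> b, \<kappa> b') | b b'. b \<in> Y \<and> b' \<in> Y \<and> f (fst u) b = f (snd u) b'}"
      unfolding cell_def V_def inc_def by fastforce
    moreover have "finite {(\<kappa> b, \<kappa> b') | b b'. b \<in> Y \<and> b' \<in> Y \<and> f (fst u) b = f (snd u) b'}"
      by (rule finite_subset[of _ "\<kappa> ` Y \<times> \<kappa> ` Y"]) (use Y in auto)
    ultimately have "card (cell ` {v \<in> V. inc u v}) \<le>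
        card {(\<kappa> b, \<kappa> b') | b b'. b \<in> Y \<and> b' \<in> Y \<and> f (fst u) b = f (snd u) b'}"
      by (intro card_mono)
    also have "\<dots> \<le> 4 * ?r"
      by (rule few_cells) (use u Y mono fib_b in \<open>auto simp: f_def continuous_trig_form\<close>)
    finally show "card (cell ` {v \<in> V. inc u v}) \<le> 4 * ?r" .
  next
    fix v assume v: "v \<in> V"
    have nd: "\<not> (px (fst v) = 0 \<and> py (fst v) = 0)" "\<not> (px (snd v) = 0 \<and> py (snd v) = 0)"
      using v ndY by (auto simp: V_def px_def py_def)
    \<comment> \<open>At each coordinate, the vector of a bad partner lies on the line through the
      origin spanned by the vector of \<open>v\<close>.\<close>
    have "card_le ({t \<in> full_turn. px (fst v) * py t = py (fst v) * px t} \<times>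
        {t \<in> full_turn. px (snd v) * py t = py (snd v) * px t}) (2 * 2)"
      unfolding px_def[of t for t] py_def[of t for t]
      by (intro card_le_Times ellipse_line_inter) (use nd lB in \<open>auto simp: px_def py_def\<close>)
    then have "card_le {w \<in> V. bad v w} (2 * 2)"
      by (rule card_le_subset) (use Y in \<open>auto simp: bad_def V_def\<close>)
    then show "card {w \<in> V. bad v w} \<le> 4" by (simp add: card_le_def)
  next
    fix v w assume v: "v \<in> V" and w: "w \<in> V" and nb: "\<not> bad v w"
    define k where "k z = (C * cos (fst z) + E * sin (fst z)) - (C * cos (snd z) + E * sin (snd z))" for z
    have "card_le {(s, t) \<in> full_turn \<times> full_turn.
      px (fst v) * cos s + py (fst v) * sin s + k v = px (snd v) * cos t + py (snd v) * sin t \<and>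
      px (fst w) * cos s + py (fst w) * sin s + k w = px (snd w) * cos t + py (snd w) * sin t} 4"
    proof (rule common_zeros)
      show "\<not> (px (fst v) = 0 \<and> py (fst v) = 0)" "\<not> (px (snd v) = 0 \<and> py (snd v) = 0)"
        using v ndY by (auto simp: V_def px_def py_def)
      show "(px (fst v))\<^sup>2 + (py (fst v))\<^sup>2 \<noteq> (px (snd v))\<^sup>2 + (py (snd v))\<^sup>2"
        using v by (auto simp: V_def S_def)
      show "\<not> (px (fst v) * py (fst w) = py (fst v) * px (fst w) \<and>
          px (snd v) * py (snd w) = py (snd v) * px (snd w))"
        using nb by (simp add: bad_def)
    qed
    then have "card_le {u \<in> X \<times> X. inc u v \<and> inc u w} 4"
    proof (rule card_le_subset, intro subsetI)
      fix u assume u: "u \<in> {u \<in> X \<times> X. inc u v \<and> inc u w}"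
      obtain a a' where a: "u = (a, a')" by fastforce
      have "a \<in> full_turn" "a' \<in> full_turn" using u a X(2) by blast+
      then show "u \<in> {(s, t) \<in> full_turn \<times> full_turn.
          px (fst v) * cos s + py (fst v) * sin s + k v = px (snd v) * cos t + py (snd v) * sin t \<and>
          px (fst w) * cos s + py (fst w) * sin s + k w = px (snd w) * cos t + py (snd w) * sin t}"
        using u by (simp add: a inc_def f_left k_def)
    qed
    then show "card {u \<in> X \<times> X. inc u v \<and> inc u w} \<le> 4" by (simp add: card_le_def)
  next
    fix v assume "v \<in> V"
    have "card_le ({y \<in> Y. \<kappa> y = \<kappa> (fst v)} \<times> {y \<in> Y. \<kappa> y = \<kappa> (snd v)}) (s * s)"
      using blk Y by (intro card_le_Times) (auto simp: card_le_def)
    then have "card_le {w \<in> V. cell w = cell v} (s * s)"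
      by (rule card_le_subset) (auto simp: V_def cell_def)
    then show "card {w \<in> V. cell w = cell v} \<le> s * s" by (simp add: card_le_def)
  qed
  also have "\<dots> \<le> 16 * ?r * (card X)\<^sup>2 + 4 * s\<^sup>2 * (card Y)\<^sup>2"
  proof -
    have "card V \<le> card (Y \<times> Y)" unfolding V_def using Y by (intro card_mono) auto
    then have "4 * (s * s) * card V \<le> 4 * (s * s) * (card Y)\<^sup>2"
      by (intro mult_le_mono2) (simp add: power2_eq_square card_cartesian_product)
    then show ?thesis by (simp add: power2_eq_square card_cartesian_product)
  qed
  finally have main: "card {(u, v) \<in> (X \<times> X) \<times> V. inc u v} \<le>
      16 * ?r * (card X)\<^sup>2 + 4 * s\<^sup>2 * (card Y)\<^sup>2" .
  have cX: "card_le X (card X)" and cY: "card_le Y (card Y)" using X Y by (auto simp: card_le_def)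
  \<comment> \<open>Once a and b are chosen, at most four b' have a vector of the same length, and
    each allows at most two a'.\<close>
  define T where "T = (SIGMA a : X. SIGMA b : Y.
      SIGMA b' : {b' \<in> Y. (px b')\<^sup>2 + (py b')\<^sup>2 = (px b)\<^sup>2 + (py b)\<^sup>2}. {a' \<in> full_turn. f a' b' = f a b})"
  have "card_le T (card X * (card Y * (4 * 2)))"
    unfolding T_def
  proof (intro card_le_Sigma cX cY)
    fix b show "card_le {b' \<in> Y. (px b')\<^sup>2 + (py b')\<^sup>2 = (px b)\<^sup>2 + (py b)\<^sup>2} 4"
      by (rule card_le_subset[OF ellipse_circle_inter[OF lAB, of "(px b)\<^sup>2 + (py b)\<^sup>2"]])
        (use Y in \<open>auto simp: px_def py_def\<close>)
  qed (use fib_a in auto)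
  then have exc: "card_le {(u, v) \<in> (X \<times> X) \<times> S. inc u v} (card X * (card Y * (4 * 2)))"
  proof (rule card_le_inj_on)
    let ?g = "\<lambda>(u, v). (fst u, fst v, snd v, snd u)"
    show "inj_on ?g {(u, v) \<in> (X \<times> X) \<times> S. inc u v}" by (auto simp: inj_on_def)
    show "?g ` {(u, v) \<in> (X \<times> X) \<times> S. inc u v} \<subseteq> T"
    proof (rule image_subsetI, clarify)
      fix a a' b b' assume h: "a \<in> X" "a' \<in> X" "(b, b') \<in> S" "inc (a, a') (b, b')"
      have "a' \<in> full_turn" using h X by blast
      then show "(fst (a, a'), fst (b, b'), snd (b, b'), snd (a, a')) \<in> T"
        using h by (auto simp: T_def S_def inc_def)
    qed
  qed
  let ?Q = "{((a, b), (a', b')). (a, b) \<in> X \<times> Y \<and> (a', b') \<in> X \<times> Y \<and> f a b = f a' b'}"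
  \<comment> \<open>Regrouping turns a solution into a curve together with a grid point on
    it.\<close>
  let ?g = "\<lambda>((a, b), (a', b')). ((a, a'), (b, b'))"
  have "card_le ?Q ((16 * ?r * (card X)\<^sup>2 + 4 * s\<^sup>2 * (card Y)\<^sup>2) + card X * (card Y * (4 * 2)))"
  proof (rule card_le_inj_on)
    have "finite {(u, v) \<in> (X \<times> X) \<times> V. inc u v}"
      by (rule finite_subset[of _ "(X \<times> X) \<times> V"]) (use X finV in auto)
    then show "card_le ({(u, v) \<in> (X \<times> X) \<times> V. inc u v} \<union> {(u, v) \<in> (X \<times> X) \<times> S. inc u v})
        ((16 * ?r * (card X)\<^sup>2 + 4 * s\<^sup>2 * (card Y)\<^sup>2) + card X * (card Y * (4 * 2)))"
      using main by (intro card_le_Un exc) (simp add: card_le_def)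
    show "inj_on ?g ?Q" by (auto simp: inj_on_def)
    show "?g ` ?Q \<subseteq> {(u, v) \<in> (X \<times> X) \<times> V. inc u v} \<union> {(u, v) \<in> (X \<times> X) \<times> S. inc u v}"
      by (auto simp: V_def inc_def)
  qed
  then have "card ?Q \<le> 8 * card X * card Y + 16 * ?r * (card X)\<^sup>2 + 4 * s\<^sup>2 * (card Y)\<^sup>2"
    by (simp add: card_le_def algebra_simps)
  with r that show thesis by blast
qed

section \<open>The number of values of a trigonometric form\<close>

definition value_count :: "('a \<Rightarrow> 'b \<Rightarrow> 'c) \<Rightarrow> 'a set \<Rightarrow> 'b set \<Rightarrow> nat" where
  "value_count f X Y = card (case_prod f ` (X \<times> Y))"

lemma value_count_mono:
  "finite X \<Longrightarrow> finite Y \<Longrightarrow> X' \<subseteq> X \<Longrightarrow> Y' \<subseteq> Y \<Longrightarrow> value_count f X' Y' \<le> value_count f X Y"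
  unfolding value_count_def by (intro card_mono image_mono) auto

lemma value_count_swap: "value_count (\<lambda>t s. f s t) Y X = value_count f X Y"
proof -
  have "(\<lambda>(t, s). f s t) ` (Y \<times> X) = case_prod f ` (X \<times> Y)" by force
  then show ?thesis by (simp add: value_count_def)
qed

lemma value_count_pos:
  assumes "finite X" "finite Y" "X \<noteq> {}" "Y \<noteq> {}"
  shows "value_count f X Y \<ge> 1"
proof -
  have "card (case_prod f ` (X \<times> Y)) \<noteq> 0" using assms by simp
  then show ?thesis unfolding value_count_def by linarith
qed

text \<open>With about n/s blocks, the main terms of the energy bound are of order n m^2 / s and s^2
  n^2. They balance at s^3 = m^2/n, and the size hypotheses place this s between 1 and n.\<close>

lemma trig_form_values_balanced:
  fixes l A B C E :: real
  defines "f \<equiv> trig_form l A B C E"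
  assumes X: "finite X" "X \<subseteq> full_turn" "X \<noteq> {}" and Y: "finite Y" "Y \<subseteq> full_turn" "Y \<noteq> {}"
    and ndX: "\<And>a. a \<in> X \<Longrightarrow> \<not> (C + cos a = 0 \<and> E + l * sin a = 0)"
    and ndY: "\<And>b. b \<in> Y \<Longrightarrow> \<not> (A + cos b = 0 \<and> B + l * sin b = 0)"
    and lB: "l \<noteq> 0 \<or> B \<noteq> 0" and lAB: "\<not> (l\<^sup>2 = 1 \<and> A = 0 \<and> B = 0)"
    and bal: "card X \<le> (card Y)\<^sup>2" "card Y \<le> (card X)\<^sup>2"
  shows "real (card X) powr (2/3) * real (card Y) powr (2/3) \<le> 56 * real (value_count f X Y)"
proof -
  define m n where "m = real (card X)" and "n = real (card Y)"
  have "card X \<ge> 1" "card Y \<ge> 1" using X Y by (simp_all add: Suc_le_eq card_gt_0_iff)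
  then have mn: "m \<ge> 1" "n \<ge> 1" by (simp_all add: m_def n_def)
  have "real (card X) \<le> real ((card Y)\<^sup>2)" "real (card Y) \<le> real ((card X)\<^sup>2)"
    using bal of_nat_le_iff by blast+
  then have b: "m \<le> n\<^sup>2" "n \<le> m\<^sup>2" by (simp_all add: m_def n_def)
  define t where "t = (m\<^sup>2 / n) powr (1/3)"
  have t1: "t \<ge> 1" unfolding t_def using b mn by (intro ge_one_powr_ge_zero) auto
  have t3: "t ^ 3 = m\<^sup>2 / n"
  proof -
    have "t ^ 3 = t powr 3" using t1 by simp
    also have "\<dots> = m\<^sup>2 / n" unfolding t_def powr_powr using mn by simp
    finally show ?thesis .
  qed
  have t3n: "t ^ 3 * n = m\<^sup>2" using t3 mn by simp
  have tn: "t \<le> n"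
  proof -
    have "m\<^sup>2 \<le> (n\<^sup>2)\<^sup>2" using b mn by (intro power_mono) auto
    also have "(n\<^sup>2)\<^sup>2 = n ^ 3 * n" by (simp add: power2_eq_square power3_eq_cube)
    finally have "t ^ 3 \<le> n ^ 3" unfolding t3 using mn by (simp add: divide_le_eq)
    then show ?thesis using mn t1 by simp
  qed
  have tm: "t \<le> m"
  proof -
    have "m\<^sup>2 / n \<le> m\<^sup>2" using mn by (simp add: divide_le_eq)
    also have "\<dots> \<le> m ^ 3" using mn by (intro power_increasing) auto
    finally have "t ^ 3 \<le> m ^ 3" unfolding t3 .
    then show ?thesis using mn t1 by simp
  qed
  define s where "s = nat \<lceil>t\<rceil>"
  have s: "real s \<ge> t" "real s \<le> 2 * t" using t1 unfolding s_def by linarith+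
  have s1: "s \<ge> 1" using s t1 by linarith
  have sn: "s \<le> card Y" using tn unfolding s_def n_def by (simp add: nat_le_iff ceiling_le_iff)
  let ?Q = "card {((a, b), (a', b')). (a, b) \<in> X \<times> Y \<and> (a', b') \<in> X \<times> Y \<and> f a b = f a' b'}"
  obtain r where r: "s * r \<le> card Y + s"
    and Q: "?Q \<le> 8 * card X * card Y + 16 * r * (card X)\<^sup>2 + 4 * s\<^sup>2 * (card Y)\<^sup>2"
    using trig_form_energy[OF X(1,2) Y(1,2) ndX ndY lB lAB s1] unfolding f_def by blast
  have "real ?Q \<le> real (8 * card X * card Y + 16 * r * (card X)\<^sup>2 + 4 * s\<^sup>2 * (card Y)\<^sup>2)"
    using Q of_nat_le_iff by blast
  then have Q': "real ?Q \<le> 8 * (m * n) + 16 * (r * m\<^sup>2) + 4 * ((real s)\<^sup>2 * n\<^sup>2)"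
    by (simp add: m_def n_def)
  \<comment> \<open>The contribution of equal lengths is absorbed because t m is at most m^2 = t^3
    n.\<close>
  have "m * n \<le> t\<^sup>2 * n\<^sup>2"
  proof -
    have "t * m \<le> t ^ 3 * n" unfolding t3n using tm mn by (simp add: power2_eq_square)
    then have "t * m \<le> t * (t\<^sup>2 * n)" by (simp add: power2_eq_square power3_eq_cube mult.assoc)
    then have "m \<le> t\<^sup>2 * n" using t1 by simp
    then have "m * n \<le> t\<^sup>2 * n * n" using mn by (intro mult_right_mono) auto
    then show ?thesis by (simp add: power2_eq_square mult.assoc)
  qed
  moreover have "r * m\<^sup>2 \<le> 2 * (t\<^sup>2 * n\<^sup>2)"
  proof -
    have "s * r \<le> 2 * card Y" using r sn by simp
    then have "real (s * r) \<le> real (2 * card Y)" using of_nat_le_iff by blast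
    then have "real s * r \<le> 2 * n" by (simp add: n_def)
    moreover have "t * r \<le> real s * r" using s by (intro mult_right_mono) auto
    ultimately have "t * r \<le> 2 * n" by linarith
    then have "(t * r) * (t\<^sup>2 * n) \<le> 2 * n * (t\<^sup>2 * n)" using mn by (intro mult_right_mono) auto
    then show ?thesis unfolding t3n[symmetric] by (simp add: power2_eq_square power3_eq_cube mult_ac)
  qed
  moreover have "(real s)\<^sup>2 * n\<^sup>2 \<le> 4 * (t\<^sup>2 * n\<^sup>2)"
  proof -
    have "(real s)\<^sup>2 \<le> (2 * t)\<^sup>2" using s by (intro power_mono) auto
    then have "(real s)\<^sup>2 * n\<^sup>2 \<le> (2 * t)\<^sup>2 * n\<^sup>2" by (intro mult_right_mono) auto
    then show ?thesis by (simp add: power_mult_distrib)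
  qed
  \<comment> \<open>56 = 8 + 16 * 2 + 4 * 4.\<close>
  ultimately have Q'': "real ?Q \<le> 56 * (t\<^sup>2 * n\<^sup>2)" using Q' by linarith
  define D where "D = real (value_count f X Y)"
  have "(card (X \<times> Y))\<^sup>2 \<le> value_count f X Y *
      card {(x, y) \<in> (X \<times> Y) \<times> (X \<times> Y). case_prod f x = case_prod f y}"
    unfolding value_count_def by (rule card_energy_ge) (use X Y in auto)
  also have "{(x, y) \<in> (X \<times> Y) \<times> (X \<times> Y). case_prod f x = case_prod f y} =
      {((a, b), (a', b')). (a, b) \<in> X \<times> Y \<and> (a', b') \<in> X \<times> Y \<and> f a b = f a' b'}" by auto
  finally have "real ((card (X \<times> Y))\<^sup>2) \<le> real (value_count f X Y * ?Q)" using of_nat_le_iff by blast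
  then have "(m * n)\<^sup>2 \<le> D * real ?Q" by (simp add: D_def m_def n_def card_cartesian_product)
  also have "\<dots> \<le> D * (56 * (t\<^sup>2 * n\<^sup>2))" using Q'' by (intro mult_left_mono) (auto simp: D_def)
  finally have "m\<^sup>2 * n\<^sup>2 \<le> (56 * D * t\<^sup>2) * n\<^sup>2" by (simp add: power_mult_distrib mult_ac)
  then have *: "m\<^sup>2 \<le> 56 * D * t\<^sup>2" using mn by simp
  \<comment> \<open>By the choice of t, t^2 is m^(4/3) / n^(2/3).\<close>
  have "m powr (2/3) * n powr (2/3) * t\<^sup>2 = m\<^sup>2"
  proof -
    have "t\<^sup>2 = t powr 2" using t1 by simp
    also have "\<dots> = (m powr 2 / n) powr (2/3)" unfolding t_def powr_powr using mn by simp
    also have "\<dots> = (m powr 2) powr (2/3) / n powr (2/3)"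
      by (rule powr_divide)
    also have "\<dots> = m powr (4/3) / n powr (2/3)" unfolding powr_powr by simp
    finally have "m powr (2/3) * n powr (2/3) * t\<^sup>2 = m powr (2/3) * m powr (4/3)"
      using mn by simp
    also have "\<dots> = m powr 2" by (simp flip: powr_add)
    finally show ?thesis using mn by simp
  qed
  then have "m powr (2/3) * n powr (2/3) * t\<^sup>2 \<le> 56 * D * t\<^sup>2" using * by simp
  then have "m powr (2/3) * n powr (2/3) \<le> 56 * D" using t1 by simp
  then show ?thesis by (simp add: m_def n_def D_def)
qed

text \<open>If one set has more than k^2 elements, k being the size of the other, it is thinned out
  to exactly k^2. The sizes are then balanced, and the product of the powers becomes k^2, one of the
  entries of the minimum.\<close>

lemma trig_form_values_nondegenerate:
  fixes l A B C E :: real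
  defines "f \<equiv> trig_form l A B C E"
  assumes X: "finite X" "X \<subseteq> full_turn" "X \<noteq> {}" and Y: "finite Y" "Y \<subseteq> full_turn" "Y \<noteq> {}"
    and ndX: "\<And>a. a \<in> X \<Longrightarrow> \<not> (C + cos a = 0 \<and> E + l * sin a = 0)"
    and ndY: "\<And>b. b \<in> Y \<Longrightarrow> \<not> (A + cos b = 0 \<and> B + l * sin b = 0)"
    and lB: "l \<noteq> 0 \<or> B \<noteq> 0" and lAB: "\<not> (l\<^sup>2 = 1 \<and> A = 0 \<and> B = 0)"
  shows "Min {real (card X) powr (2/3) * real (card Y) powr (2/3), (real (card X))\<^sup>2, (real (card Y))\<^sup>2}
    \<le> 56 * real (value_count f X Y)" (is "Min ?M \<le> _")
proof -
  have c1: "card X \<ge> 1" "card Y \<ge> 1" using X Y by (simp_all add: Suc_le_eq card_gt_0_iff)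
  have sub: "real (card X') powr (2/3) * real (card Y') powr (2/3) \<le> 56 * real (value_count f X Y)"
    if X': "X' \<subseteq> X" and Y': "Y' \<subseteq> Y" and ne: "X' \<noteq> {}" "Y' \<noteq> {}"
      and bal: "card X' \<le> (card Y')\<^sup>2" "card Y' \<le> (card X')\<^sup>2" for X' Y'
  proof -
    have "real (card X') powr (2/3) * real (card Y') powr (2/3) \<le> 56 * real (value_count f X' Y')"
      unfolding f_def
      by (rule trig_form_values_balanced) (use X Y X' Y' ne bal ndX ndY lB lAB finite_subset in blast)+
    also have "value_count f X' Y' \<le> value_count f X Y" by (rule value_count_mono[OF X(1) Y(1) X' Y'])
    then have "56 * real (value_count f X' Y') \<le> 56 * real (value_count f X Y)" by simp
    finally show ?thesis .
  qed
  have pw: "real (k\<^sup>2) powr (2/3) * real k powr (2/3) = (real k)\<^sup>2" if "k \<ge> 1" for k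
  proof -
    have e: "real (k\<^sup>2) = real k powr 2" using that by simp
    have "real (k\<^sup>2) powr (2/3) * real k powr (2/3) = real k powr (4/3) * real k powr (2/3)"
      unfolding e powr_powr by simp
    also have "\<dots> = real k powr 2" by (simp flip: powr_add)
    finally show ?thesis using that by simp
  qed
  have le_sq: "k \<le> (k\<^sup>2)\<^sup>2" for k :: nat
    by (metis le_trans power2_nat_le_imp_le order_refl power2_nat_le_eq_le le_square power2_eq_square)
  consider "card X > (card Y)\<^sup>2" | "card Y > (card X)\<^sup>2"
    | "card X \<le> (card Y)\<^sup>2" "card Y \<le> (card X)\<^sup>2" by linarith
  then obtain z where z: "z \<in> ?M" "z \<le> 56 * real (value_count f X Y)"
  proof cases
    case 1
    then obtain X' where X': "X' \<subseteq> X" "card X' = (card Y)\<^sup>2"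
      by (metis less_imp_le obtain_subset_with_card_n)
    then have "X' \<noteq> {}" using c1 by auto
    then show ?thesis
      using that[of "(real (card Y))\<^sup>2"] sub[of X' Y] X' Y le_sq pw[OF c1(2)] by auto
  next
    case 2
    then obtain Y' where Y': "Y' \<subseteq> Y" "card Y' = (card X)\<^sup>2"
      by (metis less_imp_le obtain_subset_with_card_n)
    then have "Y' \<noteq> {}" using c1 by auto
    then show ?thesis
      using that[of "(real (card X))\<^sup>2"] sub[of X Y'] Y' X le_sq pw[OF c1(1)] by (auto simp: mult.commute)
  next
    case 3
    then show ?thesis using that sub[of X Y] X Y by auto
  qed
  show ?thesis by (rule order_trans[OF Min_le[OF _ z(1)] z(2)]) simp
qed

lemma trig_form_degenerate:
  "card_le {t \<in> full_turn. A + cos t = 0 \<and> B + l * sin t = 0} 2"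
  by (rule card_le_subset[OF trig_poly1_zeros[of A 1 0]]) auto

text \<open>If a set has at most three elements, the minimum is at most 9 and a single value
  suffices. Otherwise discarding at most two degenerate angles keeps at least half of each set, so
  each entry of the minimum shrinks by a factor of at most 4, and 224 = 4 * 56.\<close>

lemma trig_form_values_oriented:
  fixes l A B C E :: real
  defines "f \<equiv> trig_form l A B C E"
  assumes X: "finite X" "X \<subseteq> full_turn" "X \<noteq> {}" and Y: "finite Y" "Y \<subseteq> full_turn" "Y \<noteq> {}"
    and lB: "l \<noteq> 0 \<or> B \<noteq> 0" and lAB: "\<not> (l\<^sup>2 = 1 \<and> A = 0 \<and> B = 0)"
  shows "Min {real (card X) powr (2/3) * real (card Y) powr (2/3), (real (card X))\<^sup>2, (real (card Y))\<^sup>2}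
    \<le> 224 * real (value_count f X Y)" (is "Min ?M \<le> _")
proof (cases "card X \<le> 3 \<or> card Y \<le> 3")
  case True
  have pos: "1 \<le> real (value_count f X Y)" using value_count_pos[OF X(1) Y(1) X(3) Y(3), of f] by simp
  have sq: "(real k)\<^sup>2 \<le> 9" if "k \<le> 3" for k :: nat
  proof -
    have "(real k)\<^sup>2 \<le> 3\<^sup>2" using that by (intro power_mono) auto
    then show ?thesis by simp
  qed
  have "Min ?M \<le> 9"
    using True
  proof
    assume "card X \<le> 3"
    then show ?thesis by (intro order_trans[OF Min_le[of ?M "(real (card X))\<^sup>2"] sq]) auto
  next
    assume "card Y \<le> 3"
    then show ?thesis by (intro order_trans[OF Min_le[of ?M "(real (card Y))\<^sup>2"] sq]) auto
  qed
  then show ?thesis using pos by linarith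
next
  case False
  have half: "\<exists>Z' \<subseteq> Z. Z' \<noteq> {} \<and> real (card Z) \<le> 2 * real (card Z') \<and> (\<forall>z\<in>Z'. \<not> P z)"
    if "card_le {t \<in> full_turn. P t} 2" "finite Z" "Z \<subseteq> full_turn" "\<not> card Z \<le> 3" for Z P
  proof (intro exI conjI)
    have "card {z \<in> Z. P z} \<le> 2"
      using that(1,3) card_le_subset[of _ 2 "{z \<in> Z. P z}"] unfolding card_le_def by blast
    moreover have "card {z \<in> Z. \<not> P z} = card Z - card {z \<in> Z. P z}"
    proof -
      have "{z \<in> Z. \<not> P z} = Z - {z \<in> Z. P z}" by auto
      then show ?thesis using that(2) by (simp add: card_Diff_subset)
    qed
    ultimately have c: "card Z \<le> 2 * card {z \<in> Z. \<not> P z}" using that(4) by linarith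
    then show "real (card Z) \<le> 2 * real (card {z \<in> Z. \<not> P z})" by simp
    show "{z \<in> Z. \<not> P z} \<noteq> {}" using c that(4) by force
  qed auto
  obtain X' where X': "X' \<subseteq> X" "X' \<noteq> {}" "real (card X) \<le> 2 * real (card X')"
      "\<forall>a\<in>X'. \<not> (C + cos a = 0 \<and> E + l * sin a = 0)"
    using half[OF trig_form_degenerate[of C E l] X(1,2)] False by blast
  obtain Y' where Y': "Y' \<subseteq> Y" "Y' \<noteq> {}" "real (card Y) \<le> 2 * real (card Y')"
      "\<forall>b\<in>Y'. \<not> (A + cos b = 0 \<and> B + l * sin b = 0)"
    using half[OF trig_form_degenerate[of A B l] Y(1,2)] False by blast
  have fin': "finite X'" "finite Y'" using X Y X' Y' finite_subset by blast+
  let ?M' = "{real (card X') powr (2/3) * real (card Y') powr (2/3), (real (card X'))\<^sup>2, (real (card Y'))\<^sup>2}"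
  have "Min ?M' \<le> 56 * real (value_count f X' Y')"
    unfolding f_def
    by (rule trig_form_values_nondegenerate) (use fin' X Y X' Y' lB lAB in blast)+
  also have "\<dots> \<le> 56 * real (value_count f X Y)" using value_count_mono[OF X(1) Y(1) X'(1) Y'(1), of f] by simp
  finally have le: "Min ?M' \<le> 56 * real (value_count f X Y)" .
  have sq: "x\<^sup>2 \<le> 4 * y\<^sup>2" if "x \<le> 2 * y" "0 \<le> x" for x y :: real
    using power_mono[OF that, of 2] by (simp add: power_mult_distrib)
  have pw: "x powr (2/3) \<le> 2 * y powr (2/3)" if "x \<le> 2 * y" "0 \<le> x" "0 \<le> y" for x y :: real
  proof -
    have "x powr (2/3) \<le> (2 * y) powr (2/3)" using that by (intro powr_mono2) auto
    also have "\<dots> = 2 powr (2/3) * y powr (2/3)" using that by (simp add: powr_mult)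
    also have "\<dots> \<le> 2 powr 1 * y powr (2/3)" by (intro mult_right_mono powr_mono) auto
    finally show ?thesis by simp
  qed
  have "real (card X) powr (2/3) * real (card Y) powr (2/3) \<le>
      (2 * real (card X') powr (2/3)) * (2 * real (card Y') powr (2/3))"
    using X'(3) Y'(3) by (intro mult_mono pw) auto
  then have prod: "real (card X) powr (2/3) * real (card Y) powr (2/3) \<le>
      4 * (real (card X') powr (2/3) * real (card Y') powr (2/3))" by simp
  have "Min ?M \<le> 4 * Min ?M'"
  proof -
    have "Min ?M' \<in> ?M'" by (rule Min_in) auto
    then obtain z where z: "z \<in> ?M" "z \<le> 4 * Min ?M'"
      using prod sq[OF X'(3)] sq[OF Y'(3)] by (metis insert_iff of_nat_0_le_iff singletonD)
    show ?thesis by (rule order_trans[OF Min_le[OF _ z(1)] z(2)]) simp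
  qed
  with le show ?thesis by linarith
qed

lemma trig_form_values_ge:
  fixes l A B C E :: real
  assumes X: "finite X" "X \<subseteq> full_turn" "X \<noteq> {}" and Y: "finite Y" "Y \<subseteq> full_turn" "Y \<noteq> {}"
    and al: "\<not> (l\<^sup>2 = 1 \<and> A = 0 \<and> B = 0)" and perp: "\<not> (l = 0 \<and> B = 0 \<and> E = 0)"
  shows "Min {real (card X) powr (2/3) * real (card Y) powr (2/3), (real (card X))\<^sup>2, (real (card Y))\<^sup>2}
    \<le> 224 * real (value_count (trig_form l A B C E) X Y)"
proof (cases "l \<noteq> 0 \<or> B \<noteq> 0")
  case True
  then show ?thesis by (rule trig_form_values_oriented[OF X Y _ al])
next
  case False
  \<comment> \<open>Here l = B = 0, so E is nonzero; exchanging the circles exchanges (A, B) with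
    (C, E).\<close>
  then have lE: "l \<noteq> 0 \<or> E \<noteq> 0" "\<not> (l\<^sup>2 = 1 \<and> C = 0 \<and> E = 0)" using perp by auto
  have "value_count (trig_form l C E A B) Y X = value_count (trig_form l A B C E) X Y"
    using value_count_swap[of "trig_form l A B C E" Y X] by (simp add: trig_form_swap[of l A B C E])
  then show ?thesis
    using trig_form_values_oriented[OF Y X lE, of A B] by (simp add: mult.commute insert_commute)
qed

section \<open>Pairs of circles\<close>

definition circle_point :: "real^3 \<Rightarrow> real \<Rightarrow> real^3 \<Rightarrow> real^3 \<Rightarrow> real \<Rightarrow> real^3" where
  "circle_point c r u v t = c + (r * cos t) *\<^sub>R u + (r * sin t) *\<^sub>R v"

lemma cross_unit_basis:
  fixes u w :: "real^3"
  assumes u: "norm u = 1" and w: "norm w = 1" and uw: "u \<bullet> w = 0"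
  shows "norm (cross3 w u) = 1"
    and "x = (u \<bullet> x) *\<^sub>R u + (cross3 w u \<bullet> x) *\<^sub>R cross3 w u + (w \<bullet> x) *\<^sub>R w"
proof -
  let ?v = "cross3 w u"
  have "(norm ?v)\<^sup>2 = 1" using norm_cross[of w u] assms by (simp add: inner_commute)
  then show n: "norm ?v = 1" using power2_eq_iff_nonneg[of "norm ?v" 1] by simp
  have o: "u \<bullet> ?v = 0" "w \<bullet> ?v = 0" by (simp_all add: dot_cross_self)
  have i: "u \<bullet> u = 1" "w \<bullet> w = 1" "?v \<bullet> ?v = 1"
    using u w n by (simp_all add: dot_square_norm)
  \<comment> \<open>The remainder is orthogonal to u and w, so its cross product with w x u vanishes
    by Lagrange's formula; as it is also orthogonal to that vector, it is 0.\<close>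
  define y where "y = x - ((u \<bullet> x) *\<^sub>R u + (?v \<bullet> x) *\<^sub>R ?v + (w \<bullet> x) *\<^sub>R w)"
  have "y \<bullet> u = 0" "y \<bullet> w = 0" "?v \<bullet> y = 0"
    using o i uw by (simp_all add: y_def inner_diff_left inner_diff_right inner_add_left inner_add_right inner_commute)
  then have "cross3 y ?v = 0" "y \<bullet> ?v = 0" by (simp_all add: Lagrange inner_commute)
  then have "y = 0 \<or> ?v = 0" using norm_and_cross_eq_0 by blast
  then have "y = 0" using n by auto
  then show "x = (u \<bullet> x) *\<^sub>R u + (?v \<bullet> x) *\<^sub>R ?v + (w \<bullet> x) *\<^sub>R w" by (simp add: y_def)
qed

lemma circle_frame:
  assumes "is_circle C"
  obtains c r w where "r > 0" "norm w = 1" "C = sphere c r \<inter> {x. w \<bullet> (x - c) = 0}"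
    "circle_plane C = {x. w \<bullet> (x - c) = 0}" "circle_center C = c"
proof -
  obtain H c r where H: "is_plane H" "c \<in> H" "r > 0" "C = sphere c r \<inter> H"
    using assms unfolding is_circle_def by blast
  \<comment> \<open>In dimension three a plane is a hyperplane, so a single normal describes
    it.\<close>
  have "aff_dim H = DIM(real^3) - 1" using H by (simp add: is_plane_def)
  then obtain a b where a: "a \<noteq> 0" "affine hull H = {x. a \<bullet> x = b}"
    using aff_dim_eq_hyperplane[of H] by auto
  have "affine hull H = H" using H by (simp add: is_plane_def affine_hull_eq)
  then have Hab: "H = {x. a \<bullet> x = b}" using a by simp
  then have b: "b = a \<bullet> c" using H by auto
  have "H = {x. (a /\<^sub>R norm a) \<bullet> (x - c) = 0}"
    unfolding Hab b using a by (auto simp: inner_diff_right)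
  then show thesis
    using that[of r "a /\<^sub>R norm a" c] a H circle_plane_eq[OF H(1-3)] circle_center_eq[OF H(1-3)]
    by simp
qed

lemma circle_parametrisation:
  fixes u w c :: "real^3"
  assumes u: "norm u = 1" and w: "norm w = 1" and uw: "u \<bullet> w = 0" and r: "r > 0"
  shows "circle_point c r u (cross3 w u) t \<in> sphere c r \<inter> {x. w \<bullet> (x - c) = 0}"
    and "x \<in> sphere c r \<inter> {x. w \<bullet> (x - c) = 0} \<Longrightarrow>
      \<exists>t\<in>full_turn. x = circle_point c r u (cross3 w u) t"
proof -
  let ?v = "cross3 w u"
  note n = cross_unit_basis(1)[OF u w uw]
  have o: "u \<bullet> ?v = 0" "w \<bullet> ?v = 0" by (simp_all add: dot_cross_self)
  have i: "u \<bullet> u = 1" "?v \<bullet> ?v = 1" using u n by (simp_all add: dot_square_norm)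
  have nrm: "(norm (a *\<^sub>R u + b *\<^sub>R ?v))\<^sup>2 = a\<^sup>2 + b\<^sup>2" for a b
    unfolding power2_norm_eq_inner
    using o i by (simp add: inner_add_left inner_add_right inner_commute power2_eq_square)
  have "(norm ((r * cos t) *\<^sub>R u + (r * sin t) *\<^sub>R ?v))\<^sup>2 = r\<^sup>2"
    unfolding nrm power_mult_distrib by (simp flip: distrib_left)
  then have "norm ((r * cos t) *\<^sub>R u + (r * sin t) *\<^sub>R ?v) = r"
    using r by (simp add: power2_eq_iff_nonneg)
  then have "dist (circle_point c r u ?v t) c = r"
    by (simp add: circle_point_def dist_norm add.assoc)
  moreover have "w \<bullet> (circle_point c r u ?v t - c) = 0"
    using o uw by (simp add: circle_point_def add.assoc inner_add_right inner_commute)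
  ultimately show "circle_point c r u ?v t \<in> sphere c r \<inter> {x. w \<bullet> (x - c) = 0}"
    by (simp add: dist_commute)
  assume x: "x \<in> sphere c r \<inter> {x. w \<bullet> (x - c) = 0}"
  then have e: "x - c = (u \<bullet> (x - c)) *\<^sub>R u + (?v \<bullet> (x - c)) *\<^sub>R ?v"
    using cross_unit_basis(2)[OF u w uw, of "x - c"] by simp
  have "(norm (x - c))\<^sup>2 = (u \<bullet> (x - c))\<^sup>2 + (?v \<bullet> (x - c))\<^sup>2" by (subst e) (rule nrm)
  moreover have "norm (x - c) = r" using x by (simp add: dist_norm norm_minus_commute)
  ultimately have "(u \<bullet> (x - c))\<^sup>2 + (?v \<bullet> (x - c))\<^sup>2 = r\<^sup>2" by simp
  moreover have "((u \<bullet> (x - c)) / r)\<^sup>2 + ((?v \<bullet> (x - c)) / r)\<^sup>2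
      = ((u \<bullet> (x - c))\<^sup>2 + (?v \<bullet> (x - c))\<^sup>2) / r\<^sup>2"
    by (simp add: power_divide add_divide_distrib)
  ultimately have "((u \<bullet> (x - c)) / r)\<^sup>2 + ((?v \<bullet> (x - c)) / r)\<^sup>2 = 1" using r by simp
  then obtain t where "0 \<le> t" "t < 2 * pi" "(u \<bullet> (x - c)) / r = cos t" "(?v \<bullet> (x - c)) / r = sin t"
    using sincos_total_2pi by metis
  then have t: "t \<in> full_turn" "u \<bullet> (x - c) = r * cos t" "?v \<bullet> (x - c) = r * sin t"
    using r by (auto simp: field_simps)
  have "x = circle_point c r u ?v t"
    using e unfolding t by (simp add: circle_point_def algebra_simps)
  then show "\<exists>t\<in>full_turn. x = circle_point c r u ?v t" using t by blast
qed

text \<open>For the unit normals of two planes this yields a direction parallel to both planes, from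
  which the angles on both circles are measured.\<close>

lemma ex_common_orthogonal_unit:
  fixes w1 w2 :: "real^3"
  obtains u where "norm u = 1" "u \<bullet> w1 = 0" "u \<bullet> w2 = 0"
proof -
  have "dim {w1, w2} \<le> card {w1, w2}" by (rule dim_le_card') simp
  also have "\<dots> \<le> 2" by (simp add: card_insert_if)
  finally have "dim {w1, w2} < DIM(real^3)" by simp
  then obtain y where y: "y \<noteq> 0" "\<And>z. z \<in> span {w1, w2} \<Longrightarrow> orthogonal y z"
    using orthogonal_to_subspace_exists by blast
  then have "y \<bullet> w1 = 0" "y \<bullet> w2 = 0" by (auto simp: orthogonal_def span_base)
  with y show thesis using that[of "y /\<^sub>R norm y"] by simp
qed

lemma unit_inner_sq_eq_1:
  fixes x y :: "'a::real_inner"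
  assumes "norm x = 1" "norm y = 1" "(x \<bullet> y)\<^sup>2 = 1"
  shows "y = (x \<bullet> y) *\<^sub>R x"
proof -
  have "(norm (y - (x \<bullet> y) *\<^sub>R x))\<^sup>2 = (norm y)\<^sup>2 - (x \<bullet> y)\<^sup>2 * (2 - (norm x)\<^sup>2)"
    unfolding power2_norm_eq_inner
    by (simp add: inner_diff_left inner_diff_right inner_commute power2_eq_square algebra_simps)
  then show ?thesis using assms by simp
qed

text \<open>Since both frames share u, orthogonal to v1 and v2, the mixed products cos s sin t and
  sin s cos t drop out, and cos s cos t gets coefficient 1 after division by 2 r1 r2.\<close>

lemma dist_circle_points:
  fixes u v1 v2 c1 c2 :: "real^3"
  assumes n: "norm u = 1" "norm v1 = 1" "norm v2 = 1" and o: "u \<bullet> v1 = 0" "u \<bullet> v2 = 0"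
    and r: "r1 > 0" "r2 > 0"
  defines "q \<equiv> c2 - c1"
  shows "(dist (circle_point c1 r1 u v1 s) (circle_point c2 r2 u v2 t))\<^sup>2 =
    (r1\<^sup>2 + r2\<^sup>2 + (norm q)\<^sup>2) - 2 * r1 * r2 *
      trig_form (v1 \<bullet> v2) (u \<bullet> q / r2) (v1 \<bullet> q / r2) (- (u \<bullet> q) / r1) (- (v2 \<bullet> q) / r1) s t"
proof -
  have i: "u \<bullet> u = 1" "v1 \<bullet> v1 = 1" "v2 \<bullet> v2 = 1" using n by (simp_all add: dot_square_norm)
  have c: "v1 \<bullet> u = 0" "v2 \<bullet> u = 0" "v2 \<bullet> v1 = v1 \<bullet> v2" "q \<bullet> u = u \<bullet> q" "q \<bullet> v1 = v1 \<bullet> q" "q \<bullet> v2 = v2 \<bullet> q"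
    using o by (simp_all add: inner_commute)
  have exp: "(norm (a *\<^sub>R u + b *\<^sub>R v1 - q - a' *\<^sub>R u - b' *\<^sub>R v2))\<^sup>2 =
      (a\<^sup>2 + b\<^sup>2) + (a'\<^sup>2 + b'\<^sup>2) + (norm q)\<^sup>2 - 2 * (a * a' + (v1 \<bullet> v2) * (b * b'))
      - 2 * (a * (u \<bullet> q) + b * (v1 \<bullet> q)) + 2 * (a' * (u \<bullet> q) + b' * (v2 \<bullet> q))" for a b a' b'
    unfolding power2_norm_eq_inner
    by (simp add: inner_diff_left inner_diff_right inner_add_left inner_add_right i o c
        power2_eq_square algebra_simps)
  have "circle_point c1 r1 u v1 s - circle_point c2 r2 u v2 t =
      (r1 * cos s) *\<^sub>R u + (r1 * sin s) *\<^sub>R v1 - q - (r2 * cos t) *\<^sub>R u - (r2 * sin t) *\<^sub>R v2"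
    by (simp add: circle_point_def q_def)
  then have "(dist (circle_point c1 r1 u v1 s) (circle_point c2 r2 u v2 t))\<^sup>2 =
      r1\<^sup>2 * ((cos s)\<^sup>2 + (sin s)\<^sup>2) + r2\<^sup>2 * ((cos t)\<^sup>2 + (sin t)\<^sup>2) + (norm q)\<^sup>2
      - 2 * ((r1 * cos s) * (r2 * cos t) + (v1 \<bullet> v2) * ((r1 * sin s) * (r2 * sin t)))
      - 2 * ((r1 * cos s) * (u \<bullet> q) + (r1 * sin s) * (v1 \<bullet> q))
      + 2 * ((r2 * cos t) * (u \<bullet> q) + (r2 * sin t) * (v2 \<bullet> q))"
    unfolding dist_norm by (simp only: exp power_mult_distrib distrib_left)
  also have "\<dots> = (r1\<^sup>2 + r2\<^sup>2 + (norm q)\<^sup>2) - 2 * r1 * r2 *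
      trig_form (v1 \<bullet> v2) (u \<bullet> q / r2) (v1 \<bullet> q / r2) (- (u \<bullet> q) / r1) (- (v2 \<bullet> q) / r1) s t"
    using r by (simp add: trig_form_def field_simps)
  finally show ?thesis .
qed

section \<open>Alignment and perpendicularity in terms of frames\<close>

lemma circle_axis_frame:
  fixes u w c :: "real^3"
  assumes u: "norm u = 1" and w: "norm w = 1" and uw: "u \<bullet> w = 0"
    and pl: "circle_plane C = {x. w \<bullet> (x - c) = 0}" and ce: "circle_center C = c"
  shows "circle_axis C = {x. u \<bullet> (x - c) = 0 \<and> cross3 w u \<bullet> (x - c) = 0}"
proof (intro equalityI subsetI)
  fix x assume x: "x \<in> circle_axis C"
  have "c + u \<in> circle_plane C" "c + cross3 w u \<in> circle_plane C"
    using uw by (simp_all add: pl dot_cross_self inner_commute)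
  with x show "x \<in> {x. u \<bullet> (x - c) = 0 \<and> cross3 w u \<bullet> (x - c) = 0}"
    unfolding circle_axis_def ce by (force simp: orthogonal_def inner_commute)
next
  fix x assume x: "x \<in> {x. u \<bullet> (x - c) = 0 \<and> cross3 w u \<bullet> (x - c) = 0}"
  have "(x - c) \<bullet> (y - c) = 0" if "w \<bullet> (y - c) = 0" for y
  proof -
    have "y - c = (u \<bullet> (y - c)) *\<^sub>R u + (cross3 w u \<bullet> (y - c)) *\<^sub>R cross3 w u"
      using cross_unit_basis(2)[OF u w uw, of "y - c"] that by simp
    then have "(x - c) \<bullet> (y - c) =
        (u \<bullet> (y - c)) * ((x - c) \<bullet> u) + (cross3 w u \<bullet> (y - c)) * ((x - c) \<bullet> cross3 w u)"
      by (metis inner_add_right inner_scaleR_right)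
    then show ?thesis using x by (simp add: inner_commute)
  qed
  then show "x \<in> circle_axis C" by (simp add: circle_axis_def pl ce orthogonal_def)
qed

lemma plane_normal_frame:
  fixes u w c :: "real^3"
  assumes u: "norm u = 1" and w: "norm w = 1" and uw: "u \<bullet> w = 0"
  shows "plane_normal {x. w \<bullet> (x - c) = 0} n \<longleftrightarrow> n \<noteq> 0 \<and> n = (w \<bullet> n) *\<^sub>R w"
proof
  assume n: "plane_normal {x. w \<bullet> (x - c) = 0} n"
  have mem: "c \<in> {x. w \<bullet> (x - c) = 0}" "c + u \<in> {x. w \<bullet> (x - c) = 0}"
    "c + cross3 w u \<in> {x. w \<bullet> (x - c) = 0}"
    using uw by (simp_all add: dot_cross_self inner_commute)
  have "orthogonal n ((c + u) - c)" "orthogonal n ((c + cross3 w u) - c)"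
    using n mem unfolding plane_normal_def by blast+
  then have "u \<bullet> n = 0" "cross3 w u \<bullet> n = 0" by (simp_all add: orthogonal_def inner_commute)
  then show "n \<noteq> 0 \<and> n = (w \<bullet> n) *\<^sub>R w"
    using cross_unit_basis(2)[OF u w uw, of n] n by (simp add: plane_normal_def)
next
  assume n: "n \<noteq> 0 \<and> n = (w \<bullet> n) *\<^sub>R w"
  have "n \<bullet> (x - y) = 0" if "w \<bullet> (x - c) = 0" "w \<bullet> (y - c) = 0" for x y
  proof -
    have "w \<bullet> (x - y) = 0" using that by (simp add: inner_diff_right)
    then show ?thesis using n by (metis inner_scaleR_left mult_zero_right)
  qed
  then show "plane_normal {x. w \<bullet> (x - c) = 0} n"
    using n by (simp add: plane_normal_def orthogonal_def)
qed

lemma circle_pair_normal_form: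
  assumes C1: "is_circle C1" and C2: "is_circle C2"
  obtains k :: real and p1 p2 :: "real \<Rightarrow> real^3" and K l A B C E :: real
  where "k > 0"
    "range p1 \<subseteq> C1" "C1 \<subseteq> p1 ` full_turn" "range p2 \<subseteq> C2" "C2 \<subseteq> p2 ` full_turn"
    "\<forall>s t. (dist (p1 s) (p2 t))\<^sup>2 = K - k * trig_form l A B C E s t"
    "aligned C1 C2 \<longleftrightarrow> l\<^sup>2 = 1 \<and> A = 0 \<and> B = 0"
    "aligned C1 C2 \<longrightarrow> C = 0 \<and> E = 0"
    "perpendicular_circles C1 C2 \<longleftrightarrow> l = 0 \<and> B = 0 \<and> E = 0"
proof -
  obtain c1 r1 w1 where r1: "r1 > 0" and w1: "norm w1 = 1"
    and C1: "C1 = sphere c1 r1 \<inter> {x. w1 \<bullet> (x - c1) = 0}"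
    and pl1: "circle_plane C1 = {x. w1 \<bullet> (x - c1) = 0}" and ce1: "circle_center C1 = c1"
    using circle_frame[OF C1] .
  obtain c2 r2 w2 where r2: "r2 > 0" and w2: "norm w2 = 1"
    and C2: "C2 = sphere c2 r2 \<inter> {x. w2 \<bullet> (x - c2) = 0}"
    and pl2: "circle_plane C2 = {x. w2 \<bullet> (x - c2) = 0}" and ce2: "circle_center C2 = c2"
    using circle_frame[OF C2] .
  obtain u where u: "norm u = 1" and uw: "u \<bullet> w1 = 0" "u \<bullet> w2 = 0"
    using ex_common_orthogonal_unit .
  define v1 v2 where "v1 = cross3 w1 u" and "v2 = cross3 w2 u"
  define q where "q = c2 - c1"
  define l where "l = v1 \<bullet> v2"
  have n: "norm v1 = 1" "norm v2 = 1"
    unfolding v1_def v2_def using cross_unit_basis(1) u w1 w2 uw by auto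
  have uv: "u \<bullet> v1 = 0" "u \<bullet> v2 = 0" by (simp_all add: v1_def v2_def dot_cross_self)
  \<comment> \<open>Both normals are turned by a quarter turn about u, which preserves their inner
    product.\<close>
  have lw: "l = w1 \<bullet> w2"
    using u uw by (simp add: l_def v1_def v2_def dot_cross dot_square_norm inner_commute)
  have expand1: "x = (u \<bullet> x) *\<^sub>R u + (v1 \<bullet> x) *\<^sub>R v1 + (w1 \<bullet> x) *\<^sub>R w1" for x
    unfolding v1_def by (rule cross_unit_basis(2)[OF u w1 uw(1)])
  have expand2: "x = (u \<bullet> x) *\<^sub>R u + (v2 \<bullet> x) *\<^sub>R v2 + (w2 \<bullet> x) *\<^sub>R w2" for x
    unfolding v2_def by (rule cross_unit_basis(2)[OF u w2 uw(2)])
  have ax1: "circle_axis C1 = {x. u \<bullet> (x - c1) = 0 \<and> v1 \<bullet> (x - c1) = 0}"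
    unfolding v1_def by (rule circle_axis_frame[OF u w1 uw(1) pl1 ce1])
  have ax2: "circle_axis C2 = {x. u \<bullet> (x - c2) = 0 \<and> v2 \<bullet> (x - c2) = 0}"
    unfolding v2_def by (rule circle_axis_frame[OF u w2 uw(2) pl2 ce2])
  have q_neg: "z \<bullet> (c1 - c2) = - (z \<bullet> q)" for z by (simp add: q_def inner_diff_right)

  have al: "l\<^sup>2 = 1 \<and> u \<bullet> q = 0 \<and> v1 \<bullet> q = 0 \<and> v2 \<bullet> q = 0" if "aligned C1 C2"
  proof -
    have eq: "circle_axis C1 = circle_axis C2" using that by (simp add: aligned_def)
    \<comment> \<open>Since c1 and c1 + w1 lie on the axis of \<open>C2\<close>, the normal w1 is
      orthogonal to v2 as well as to u, hence a multiple of w2.\<close>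
    have "c1 \<in> circle_axis C1" "c1 + w1 \<in> circle_axis C1"
      using uw by (simp_all add: ax1 v1_def dot_cross_self)
    then have 1: "u \<bullet> (c1 - c2) = 0" "v2 \<bullet> (c1 - c2) = 0" "v2 \<bullet> (c1 + w1 - c2) = 0"
      unfolding eq ax2 by auto
    have "c2 \<in> circle_axis C2" by (simp add: ax2)
    then have "v1 \<bullet> (c2 - c1) = 0" unfolding eq[symmetric] ax1 by simp
    moreover have "v2 \<bullet> w1 = v2 \<bullet> (c1 + w1 - c2) - v2 \<bullet> (c1 - c2)"
      by (simp add: inner_diff_right inner_add_right)
    then have "w1 = (w2 \<bullet> w1) *\<^sub>R w2" using expand2[of w1] 1 uw by simp
    then have "norm w1 = \<bar>w2 \<bullet> w1\<bar> * norm w2" by (metis norm_scaleR)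
    then have "\<bar>l\<bar> = 1" using w1 w2 by (simp add: lw inner_commute)
    then have "l\<^sup>2 = 1" by (metis one_power2 power2_abs)
    ultimately show ?thesis using 1 by (simp add: q_neg) (simp add: q_def)
  qed
  have al': "aligned C1 C2" if l: "l\<^sup>2 = 1" and q: "u \<bullet> q = 0" "v1 \<bullet> q = 0"
  proof -
    have "w2 = l *\<^sub>R w1" unfolding lw by (rule unit_inner_sq_eq_1) (use w1 w2 l lw in auto)
    then have v2: "v2 = l *\<^sub>R v1" by (simp add: v1_def v2_def cross_mult_left)
    have "l \<noteq> 0" using l by auto
    have "z \<bullet> (x - c2) = z \<bullet> (x - c1) - z \<bullet> q" for x z by (simp add: q_def inner_diff_right)
    then have "u \<bullet> (x - c2) = u \<bullet> (x - c1)" "v2 \<bullet> (x - c2) = l * (v1 \<bullet> (x - c1))" for x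
      using q by (simp_all add: v2)
    then show ?thesis using \<open>l \<noteq> 0\<close> by (simp add: aligned_def ax1 ax2)
  qed

  have pp: "perpendicular_planes (circle_plane C1) (circle_plane C2) \<longleftrightarrow> l = 0"
  proof
    assume "perpendicular_planes (circle_plane C1) (circle_plane C2)"
    then obtain n1 n2 where n: "n1 \<noteq> 0" "n2 \<noteq> 0" "n1 = (w1 \<bullet> n1) *\<^sub>R w1" "n2 = (w2 \<bullet> n2) *\<^sub>R w2" "n1 \<bullet> n2 = 0"
      unfolding perpendicular_planes_def pl1 pl2
        plane_normal_frame[OF u w1 uw(1)] plane_normal_frame[OF u w2 uw(2)]
      unfolding orthogonal_def by blast
    have "n1 \<bullet> n2 = ((w1 \<bullet> n1) *\<^sub>R w1) \<bullet> ((w2 \<bullet> n2) *\<^sub>R w2)"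
      by (rule arg_cong2[OF n(3,4)])
    then have "n1 \<bullet> n2 = (w1 \<bullet> n1) * ((w2 \<bullet> n2) * (w1 \<bullet> w2))" by simp
    moreover have "w1 \<bullet> n1 \<noteq> 0" using n(1,3) by (metis scaleR_zero_left)
    moreover have "w2 \<bullet> n2 \<noteq> 0" using n(2,4) by (metis scaleR_zero_left)
    ultimately show "l = 0" using n(5) lw by simp
  next
    assume "l = 0"
    moreover have "w1 \<noteq> 0" "w2 \<noteq> 0" "w1 \<bullet> w1 = 1" "w2 \<bullet> w2 = 1"
      using w1 w2 by (auto simp: dot_square_norm)
    ultimately show "perpendicular_planes (circle_plane C1) (circle_plane C2)"
      unfolding perpendicular_planes_def pl1 pl2
        plane_normal_frame[OF u w1 uw(1)] plane_normal_frame[OF u w2 uw(2)]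
      by (intro exI[of _ w1] exI[of _ w2]) (simp add: lw orthogonal_def)
  qed
  have perp: "perpendicular_circles C1 C2 \<longleftrightarrow> l = 0 \<and> v1 \<bullet> q = 0 \<and> v2 \<bullet> q = 0"
  proof (cases "l = 0")
    case True
    \<comment> \<open>When the normals are orthogonal, w2 is a multiple of v1 and w1 one of v2, so
      the conditions on the centres can be stated with v1 and v2.\<close>
    then have e2: "w2 = (v1 \<bullet> w2) *\<^sub>R v1" and e1: "w1 = (v2 \<bullet> w1) *\<^sub>R v2"
      using expand1[of w2] expand2[of w1] uw by (simp_all add: lw inner_commute)
    have "w2 \<bullet> q = ((v1 \<bullet> w2) *\<^sub>R v1) \<bullet> q" by (rule arg_cong[OF e2])
    moreover have "w1 \<bullet> q = ((v2 \<bullet> w1) *\<^sub>R v2) \<bullet> q" by (rule arg_cong[OF e1])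
    ultimately have e: "w2 \<bullet> q = (v1 \<bullet> w2) * (v1 \<bullet> q)" "w1 \<bullet> q = (v2 \<bullet> w1) * (v2 \<bullet> q)" by simp_all
    have "w1 \<noteq> 0" "w2 \<noteq> 0" using w1 w2 by auto
    then have nz: "v1 \<bullet> w2 \<noteq> 0" "v2 \<bullet> w1 \<noteq> 0" using e1 e2 by (metis scaleR_zero_left)+
    have "perpendicular_circles C1 C2 \<longleftrightarrow> w2 \<bullet> (c1 - c2) = 0 \<and> w1 \<bullet> (c2 - c1) = 0"
      unfolding perpendicular_circles_def pp using True by (simp add: pl1 pl2 ce1 ce2)
    also have "\<dots> \<longleftrightarrow> w2 \<bullet> q = 0 \<and> w1 \<bullet> q = 0" unfolding q_neg by (simp add: q_def)
    finally show ?thesis using True e nz by simp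
  qed (simp add: perpendicular_circles_def pp)

  show thesis
  proof (rule that)
    show "2 * r1 * r2 > 0" using r1 r2 by simp
    show "range (circle_point c1 r1 u v1) \<subseteq> C1" "C1 \<subseteq> circle_point c1 r1 u v1 ` full_turn"
      unfolding C1 v1_def using circle_parametrisation[OF u w1 uw(1) r1] by blast+
    show "range (circle_point c2 r2 u v2) \<subseteq> C2" "C2 \<subseteq> circle_point c2 r2 u v2 ` full_turn"
      unfolding C2 v2_def using circle_parametrisation[OF u w2 uw(2) r2] by blast+
    show "\<forall>s t. (dist (circle_point c1 r1 u v1 s) (circle_point c2 r2 u v2 t))\<^sup>2 =
      (r1\<^sup>2 + r2\<^sup>2 + (norm q)\<^sup>2) - (2 * r1 * r2) *
        trig_form l (u \<bullet> q / r2) (v1 \<bullet> q / r2) (- (u \<bullet> q) / r1) (- (v2 \<bullet> q) / r1) s t"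
      unfolding l_def q_def using dist_circle_points[OF u n uv r1 r2] by blast
    show "aligned C1 C2 \<longleftrightarrow> l\<^sup>2 = 1 \<and> u \<bullet> q / r2 = 0 \<and> v1 \<bullet> q / r2 = 0"
      using al al' r2 by auto
    show "aligned C1 C2 \<longrightarrow> - (u \<bullet> q) / r1 = 0 \<and> - (v2 \<bullet> q) / r1 = 0"
      using al by auto
    show "perpendicular_circles C1 C2 \<longleftrightarrow> l = 0 \<and> v1 \<bullet> q / r2 = 0 \<and> - (v2 \<bullet> q) / r1 = 0"
      using perp r1 r2 by simp
  qed
qed

section \<open>Few distances on aligned or perpendicular circles\<close>

text \<open>The sums i + j take exactly the m + n - 1 values below m + n - 1. Comparing distances to
  the point of index 0 on the other side shows that the points are distinct.\<close>

lemma num_distances_progression: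
  fixes a b :: "nat \<Rightarrow> real^3"
  assumes d: "\<And>i j. i < m \<Longrightarrow> j < n \<Longrightarrow> dist (a i) (b j) = \<Psi> (i + j)"
    and inj: "inj_on \<Psi> {..<m + n}" and mn: "m \<ge> 1" "n \<ge> 1"
  shows "card (a ` {..<m}) = m" "card (b ` {..<n}) = n"
    "num_distances (a ` {..<m}) (b ` {..<n}) = m + n - 1"
proof -
  have "inj_on a {..<m}"
  proof (rule inj_onI)
    fix i i' assume i: "i \<in> {..<m}" "i' \<in> {..<m}" "a i = a i'"
    then have "\<Psi> i = \<Psi> i'" using d[of i 0] d[of i' 0] mn by simp
    then show "i = i'" using inj i by (auto simp: inj_on_def)
  qed
  then show "card (a ` {..<m}) = m" by (simp add: card_image)
  have "inj_on b {..<n}"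
  proof (rule inj_onI)
    fix j j' assume j: "j \<in> {..<n}" "j' \<in> {..<n}" "b j = b j'"
    then have "\<Psi> j = \<Psi> j'" using d[of 0 j] d[of 0 j'] mn by simp
    then show "j = j'" using inj j by (auto simp: inj_on_def)
  qed
  then show "card (b ` {..<n}) = n" by (simp add: card_image)
  have "{dist x y | x y. x \<in> a ` {..<m} \<and> y \<in> b ` {..<n}} = \<Psi> ` {..<m + n - 1}"
  proof (intro equalityI subsetI)
    fix z assume "z \<in> {dist x y | x y. x \<in> a ` {..<m} \<and> y \<in> b ` {..<n}}"
    then obtain i j where "i < m" "j < n" "z = \<Psi> (i + j)" using d by auto
    then show "z \<in> \<Psi> ` {..<m + n - 1}" by auto
  next
    fix z assume "z \<in> \<Psi> ` {..<m + n - 1}"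
    then obtain k where k: "k < m + n - 1" "z = \<Psi> k" by auto
    \<comment> \<open>The first index takes as much of k as it can; the rest is then below
      n.\<close>
    define i where "i = min k (m - 1)"
    have i: "i < m" "k - i < n" "k = i + (k - i)" using k mn by (auto simp: i_def)
    then have "z = dist (a i) (b (k - i))" using d[OF i(1,2)] k by simp
    then show "z \<in> {dist x y | x y. x \<in> a ` {..<m} \<and> y \<in> b ` {..<n}}" using i by blast
  qed
  moreover have "inj_on \<Psi> {..<m + n - 1}" by (rule inj_on_subset[OF inj]) auto
  ultimately show "num_distances (a ` {..<m}) (b ` {..<n}) = m + n - 1"
    by (simp add: num_distances_def card_image)
qed

text \<open>The ratio is so close to 1 that the progression starting at the endpoint of larger modulus
  stays in the interval \<open>[C - 1, C + 1]\<close>.\<close>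

lemma ex_cos_progression:
  fixes C \<rho> M :: real
  assumes M: "\<bar>C\<bar> \<le> M" and \<rho>: "0 < \<rho>" "\<rho> \<le> 1" and low: "\<And>i. i < N \<Longrightarrow> M / (1 + M) \<le> \<rho> ^ i"
  obtains x t where "x \<noteq> 0" "\<And>i::nat. i < N \<Longrightarrow> cos (t i) + C = x * \<rho> ^ i"
proof -
  define \<sigma> :: real where "\<sigma> = (if C \<ge> 0 then 1 else - 1)"
  have \<sigma>: "C = \<sigma> * \<bar>C\<bar>" "\<bar>\<sigma>\<bar> = 1" by (auto simp: \<sigma>_def)
  define x where "x = \<sigma> * (\<bar>C\<bar> + 1)"
  have "\<bar>x * \<rho> ^ i - C\<bar> \<le> 1" if "i < N" for i
  proof -
    \<comment> \<open>Monotonicity transfers the bound from M to |C|, which keeps |x| \<rho>^i at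
      least |C|.\<close>
    have "z / (1 + z) \<le> M / (1 + M)" if "0 \<le> z" "z \<le> M" for z
      using that by (simp add: field_simps)
    from this[OF _ M] have "\<bar>C\<bar> / (1 + \<bar>C\<bar>) \<le> M / (1 + M)" by simp
    then have "\<bar>C\<bar> / (1 + \<bar>C\<bar>) \<le> \<rho> ^ i" using low[OF that] by linarith
    then have "\<bar>C\<bar> \<le> (\<bar>C\<bar> + 1) * \<rho> ^ i" by (simp add: divide_le_eq mult.commute add.commute)
    moreover have "(\<bar>C\<bar> + 1) * \<rho> ^ i \<le> \<bar>C\<bar> + 1"
      using \<rho> by (intro mult_left_le power_le_one) auto
    moreover have "x * \<rho> ^ i - C = \<sigma> * ((\<bar>C\<bar> + 1) * \<rho> ^ i - \<bar>C\<bar>)"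
      using \<sigma>(1) by (simp add: x_def algebra_simps)
    ultimately show ?thesis using \<sigma>(2) by (simp add: abs_mult)
  qed
  then have "cos (arccos (x * \<rho> ^ i - C)) + C = x * \<rho> ^ i" if "i < N" for i
    using that by (simp add: cos_arccos_abs)
  moreover have "x \<noteq> 0" by (auto simp: x_def \<sigma>_def)
  ultimately show thesis using that[of x "\<lambda>i. arccos (x * \<rho> ^ i - C)"] by blast
qed

lemma ex_progressions_aligned:
  assumes "l\<^sup>2 = (1::real)" and mn: "m \<ge> 1" "n \<ge> 1"
  obtains s t \<Phi> where "\<forall>i<m. \<forall>j<n. trig_form l 0 0 0 0 (s i) (t j) = \<Phi> (i + j)"
    "inj_on \<Phi> {..<m + n :: nat}"
proof -
  have l: "l = 1 \<or> l = - 1" using assms by (simp add: power2_eq_1_iff)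
  \<comment> \<open>All multiples k \<delta> with k < m + n stay in [0, pi], where cos is injective.
    The factor -l in the angles on the second circle turns s - l t into a sum.\<close>
  define \<delta> where "\<delta> = pi / real (m + n)"
  have \<delta>: "\<delta> > 0" using mn by (simp add: \<delta>_def)
  show thesis
  proof (rule that)
    show "\<forall>i<m. \<forall>j<n. trig_form l 0 0 0 0 (real i * \<delta>) (- l * (real j * \<delta>)) = (\<lambda>k. cos (real k * \<delta>)) (i + j)"
      using l by (auto simp: trig_form_def cos_add distrib_right)
    show "inj_on (\<lambda>k. cos (real k * \<delta>)) {..<m + n}"
    proof (rule inj_onI)
      fix k k' assume k: "k \<in> {..<m + n}" "k' \<in> {..<m + n}" "cos (real k * \<delta>) = cos (real k' * \<delta>)"
      have le: "real k * \<delta> \<le> pi" if "k < m + n" for k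
      proof -
        have "real k * \<delta> \<le> real (m + n) * \<delta>" using that \<delta> by (intro mult_right_mono) auto
        then show ?thesis using mn by (simp add: \<delta>_def)
      qed
      have "real k * \<delta> = real k' * \<delta>"
      proof (rule cos_inj_pi)
        show "0 \<le> real k * \<delta>" "0 \<le> real k' * \<delta>" using \<delta> by simp_all
        show "real k * \<delta> \<le> pi" "real k' * \<delta> \<le> pi" using k(1,2) by (auto intro: le)
      qed (rule k(3))
      then have "real k = real k'" using \<delta> by (metis less_irrefl mult_right_cancel)
      then show "k = k'" by simp
    qed
  qed
qed

lemma ex_progressions_perpendicular:
  fixes A C :: real
  assumes mn: "m \<ge> 1" "n \<ge> 1"
  obtains s t \<Phi> where "\<forall>i<m. \<forall>j<n. trig_form 0 A 0 C 0 (s i) (t j) = \<Phi> (i + j)"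
    "inj_on \<Phi> {..<m + n :: nat}"
proof -
  define M where "M = \<bar>A\<bar> + \<bar>C\<bar>"
  define N where "N = m + n"
  \<comment> \<open>By Bernoulli's inequality, \<rho>^i is at least 1 - 1/(1 + M) = M/(1 + M) for
    all i < N. As M bounds both |A| and |C|, the same ratio serves both circles.\<close>
  define \<rho> where "\<rho> = 1 - 1 / (real N * (1 + M))"
  have M: "\<bar>A\<bar> \<le> M" "\<bar>C\<bar> \<le> M" "M \<ge> 0" by (auto simp: M_def)
  have N: "real N \<ge> 2" using mn by (simp add: N_def)
  have "1 < real N * (1 + M)"
    using mult_mono[of 2 "real N" 1 "1 + M"] N M by simp
  then have q: "0 < 1 / (real N * (1 + M))" "1 / (real N * (1 + M)) < 1" by auto
  then have \<rho>: "0 < \<rho>" "\<rho> < 1" unfolding \<rho>_def by linarith+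
  have low: "M / (1 + M) \<le> \<rho> ^ i" if "i < N" for i
  proof -
    have "real i / (real N * (1 + M)) \<le> real N / (real N * (1 + M))"
      using that M by (intro divide_right_mono) auto
    also have "\<dots> = 1 / (1 + M)" using N by simp
    finally have "M / (1 + M) \<le> 1 + real i * (- (1 / (real N * (1 + M))))"
      using M by (simp add: field_simps)
    also have "\<dots> \<le> (1 + (- (1 / (real N * (1 + M))))) ^ i"
      using q by (intro Bernoulli_inequality) linarith
    finally show ?thesis by (simp add: \<rho>_def)
  qed
  obtain x s where x: "x \<noteq> 0" "\<And>i. i < N \<Longrightarrow> cos (s i) + C = x * \<rho> ^ i"
    using ex_cos_progression[OF M(2) \<rho>(1) less_imp_le[OF \<rho>(2)] low] by metis
  obtain y t where y: "y \<noteq> 0" "\<And>i. i < N \<Longrightarrow> cos (t i) + A = y * \<rho> ^ i"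
    using ex_cos_progression[OF M(1) \<rho>(1) less_imp_le[OF \<rho>(2)] low] by metis
  show thesis
  proof (rule that)
    have "trig_form 0 A 0 C 0 (s i) (t j) = x * y * \<rho> ^ (i + j) - A * C" if "i < m" "j < n" for i j
    proof -
      have "trig_form 0 A 0 C 0 (s i) (t j) = (cos (s i) + C) * (cos (t j) + A) - A * C"
        by (simp add: trig_form_def algebra_simps)
      also have "\<dots> = x * y * \<rho> ^ (i + j) - A * C"
        using x(2)[of i] y(2)[of j] that by (simp add: N_def power_add)
      finally show ?thesis .
    qed
    then show "\<forall>i<m. \<forall>j<n. trig_form 0 A 0 C 0 (s i) (t j) = (\<lambda>k. x * y * \<rho> ^ k - A * C) (i + j)" by simp
  next
    show "inj_on (\<lambda>k. x * y * \<rho> ^ k - A * C) {..<m + n}"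
      using x(1) y(1) \<rho> by (auto simp: inj_on_def power_inject_exp')
  qed
qed

lemma ex_few_distances:
  assumes C1: "is_circle C1" and C2: "is_circle C2" and mn: "m \<ge> 1" "n \<ge> 1"
    and special: "aligned C1 C2 \<or> perpendicular_circles C1 C2"
  obtains P1 P2 where "P1 \<subseteq> C1" "finite P1" "card P1 = m" "P2 \<subseteq> C2" "finite P2" "card P2 = n"
    "num_distances P1 P2 = m + n - 1"
proof -
  obtain k :: real and p1 p2 :: "real \<Rightarrow> real^3" and K l A B C E :: real where k: "k > 0"
    and p1: "range p1 \<subseteq> C1" "C1 \<subseteq> p1 ` full_turn"
    and p2: "range p2 \<subseteq> C2" "C2 \<subseteq> p2 ` full_turn"
    and d: "\<forall>s t. (dist (p1 s) (p2 t))\<^sup>2 = K - k * trig_form l A B C E s t"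
    and al: "aligned C1 C2 \<longleftrightarrow> l\<^sup>2 = 1 \<and> A = 0 \<and> B = 0" "aligned C1 C2 \<longrightarrow> C = 0 \<and> E = 0"
    and perp: "perpendicular_circles C1 C2 \<longleftrightarrow> l = 0 \<and> B = 0 \<and> E = 0"
    using C1 C2 by (rule circle_pair_normal_form)
  obtain s t \<Phi> where st: "\<forall>i<m. \<forall>j<n. trig_form l A B C E (s i) (t j) = \<Phi> (i + j)"
    and inj: "inj_on \<Phi> {..<m + n}"
    using special
  proof
    assume "aligned C1 C2"
    then have z: "l\<^sup>2 = 1" "A = 0" "B = 0" "C = 0" "E = 0" using al by auto
    obtain s t \<Phi> where "\<forall>i<m. \<forall>j<n. trig_form l 0 0 0 0 (s i) (t j) = \<Phi> (i + j)"
      "inj_on \<Phi> {..<m + n}" using ex_progressions_aligned[OF z(1) mn] .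
    then show thesis by (intro that) (simp_all add: z)
  next
    assume "perpendicular_circles C1 C2"
    then have z: "l = 0" "B = 0" "E = 0" using perp by auto
    obtain s t \<Phi> where "\<forall>i<m. \<forall>j<n. trig_form 0 A 0 C 0 (s i) (t j) = \<Phi> (i + j)"
      "inj_on \<Phi> {..<m + n}" using ex_progressions_perpendicular[OF mn] .
    then show thesis by (intro that) (simp_all add: z)
  qed
  have "dist (p1 (s i)) (p2 (t j)) = sqrt (K - k * \<Phi> (i + j))" if "i < m" "j < n" for i j
    by (rule real_sqrt_unique[symmetric]) (use d st that in simp_all)
  \<comment> \<open>The index m + n - 1 belongs to no distance, so its radicand may be negative;
    \<open>sqrt\<close> is odd and injective on all reals.\<close>
  moreover have "inj_on (\<lambda>j. sqrt (K - k * \<Phi> j)) {..<m + n}"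
    using inj k by (auto simp: inj_on_def)
  ultimately have "card ((\<lambda>i. p1 (s i)) ` {..<m}) = m" "card ((\<lambda>j. p2 (t j)) ` {..<n}) = n"
    "num_distances ((\<lambda>i. p1 (s i)) ` {..<m}) ((\<lambda>j. p2 (t j)) ` {..<n}) = m + n - 1"
    using num_distances_progression[of m n "\<lambda>i. p1 (s i)" "\<lambda>j. p2 (t j)"
        "\<lambda>j. sqrt (K - k * \<Phi> j)"] mn by blast+
  then show thesis using p1(1) p2(1) by (intro that) auto
qed

section \<open>Lower bound for all other pairs and conclusion\<close>

lemma num_distances_ge:
  assumes C1: "is_circle C1" and C2: "is_circle C2"
    and ns: "\<not> aligned C1 C2" "\<not> perpendicular_circles C1 C2"
    and P1: "P1 \<subseteq> C1" "finite P1" "P1 \<noteq> {}" and P2: "P2 \<subseteq> C2" "finite P2" "P2 \<noteq> {}"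
  shows "Min {real (card P1) powr (2/3) * real (card P2) powr (2/3),
      (real (card P1))\<^sup>2, (real (card P2))\<^sup>2} \<le> 224 * real (num_distances P1 P2)"
proof -
  obtain k :: real and p1 p2 :: "real \<Rightarrow> real^3" and K l A B C E :: real where k: "k > 0"
    and p1: "range p1 \<subseteq> C1" "C1 \<subseteq> p1 ` full_turn"
    and p2: "range p2 \<subseteq> C2" "C2 \<subseteq> p2 ` full_turn"
    and d: "\<forall>s t. (dist (p1 s) (p2 t))\<^sup>2 = K - k * trig_form l A B C E s t"
    and al: "aligned C1 C2 \<longleftrightarrow> l\<^sup>2 = 1 \<and> A = 0 \<and> B = 0" "aligned C1 C2 \<longrightarrow> C = 0 \<and> E = 0"
    and perp: "perpendicular_circles C1 C2 \<longleftrightarrow> l = 0 \<and> B = 0 \<and> E = 0"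
    using C1 C2 by (rule circle_pair_normal_form)
  \<comment> \<open>One angle is chosen for each point, so that the set of angles has the same
    size.\<close>
  have sect: "\<exists>Z. finite Z \<and> Z \<subseteq> full_turn \<and> p ` Z = P \<and> card Z = card P"
    if P: "finite P" "P \<subseteq> p ` full_turn" for p :: "real \<Rightarrow> real^3" and P
  proof -
    obtain Z where Z: "Z \<subseteq> full_turn" "inj_on p Z" "P = p ` Z"
      using P(2) subset_image_inj[of P p full_turn] by blast
    then show ?thesis using P(1) finite_imageD card_image by metis
  qed
  obtain X where X: "finite X" "X \<subseteq> full_turn" "p1 ` X = P1" "card X = card P1"
    using sect[OF P1(2) order_trans[OF P1(1) p1(2)]] by blast
  obtain Y where Y: "finite Y" "Y \<subseteq> full_turn" "p2 ` Y = P2" "card Y = card P2"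
    using sect[OF P2(2) order_trans[OF P2(1) p2(2)]] by blast
  let ?f = "trig_form l A B C E" and ?D = "{dist a b | a b. a \<in> P1 \<and> b \<in> P2}"
  \<comment> \<open>The value of the form is a function of the distance, so there are at least as
    many distances as values.\<close>
  have "case_prod ?f ` (X \<times> Y) \<subseteq> (\<lambda>z. (K - z\<^sup>2) / k) ` ?D"
  proof clarify
    fix s t assume st: "s \<in> X" "t \<in> Y"
    have "?f s t = (K - (dist (p1 s) (p2 t))\<^sup>2) / k" using k by (simp add: d)
    moreover have "dist (p1 s) (p2 t) \<in> ?D" using st X(3) Y(3) by blast
    ultimately show "?f s t \<in> (\<lambda>z. (K - z\<^sup>2) / k) ` ?D" by (rule image_eqI)
  qed
  moreover have fin: "finite ?D"
    by (rule finite_subset[of _ "case_prod dist ` (P1 \<times> P2)"]) (use P1 P2 in auto)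
  ultimately have "value_count ?f X Y \<le> num_distances P1 P2"
    unfolding value_count_def num_distances_def
    by (meson card_image_le card_mono finite_imageI le_trans)
  moreover have "Min {real (card X) powr (2/3) * real (card Y) powr (2/3),
      (real (card X))\<^sup>2, (real (card Y))\<^sup>2} \<le> 224 * real (value_count ?f X Y)"
  proof (rule trig_form_values_ge[OF X(1,2) _ Y(1,2)])
    show "X \<noteq> {}" "Y \<noteq> {}" using X Y P1 P2 by auto
    show "\<not> (l\<^sup>2 = 1 \<and> A = 0 \<and> B = 0)" using al(1) ns by blast
    show "\<not> (l = 0 \<and> B = 0 \<and> E = 0)" using perp ns by blast
  qed
  ultimately show ?thesis unfolding X(4) Y(4) by linarith
qed

theorem theorem1p4:
  shows "\<exists>c c' c'' :: real. c > 0 \<and> c' > 0 \<and> c'' > 0 \<and>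
    (\<forall>(C1 :: (real^3) set) (C2 :: (real^3) set) (m :: nat) (n :: nat).
      is_circle C1 \<longrightarrow> is_circle C2 \<longrightarrow> m \<ge> 1 \<longrightarrow> n \<ge> 1 \<longrightarrow>
      (aligned C1 C2 \<or> perpendicular_circles C1 C2 \<longrightarrow>
        (\<exists>P1 P2. P1 \<subseteq> C1 \<and> finite P1 \<and> card P1 = m \<and>
                 P2 \<subseteq> C2 \<and> finite P2 \<and> card P2 = n \<and>
                 c' * (real m + real n) \<le> real (num_distances P1 P2) \<and>
                 real (num_distances P1 P2) \<le> c'' * (real m + real n))) \<and>
      (\<not> aligned C1 C2 \<and> \<not> perpendicular_circles C1 C2 \<longrightarrow>
        (\<forall>P1 P2. P1 \<subseteq> C1 \<and> finite P1 \<and> card P1 = m \<and>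
                 P2 \<subseteq> C2 \<and> finite P2 \<and> card P2 = n \<longrightarrow>
                 real (num_distances P1 P2) \<ge>
                   c * Min {real m powr (2/3) * real n powr (2/3), (real m)\<^sup>2, (real n)\<^sup>2})))"
proof (rule exI[of _ "1 / 224"], rule exI[of _ "1 / 2"], rule exI[of _ 1], intro conjI allI impI)
  fix C1 C2 :: "(real^3) set" and m n :: nat
  assume C: "is_circle C1" "is_circle C2" and mn: "m \<ge> 1" "n \<ge> 1"
  show "\<exists>P1 P2. P1 \<subseteq> C1 \<and> finite P1 \<and> card P1 = m \<and>
      P2 \<subseteq> C2 \<and> finite P2 \<and> card P2 = n \<and>
      1 / 2 * (real m + real n) \<le> real (num_distances P1 P2) \<and>
      real (num_distances P1 P2) \<le> 1 * (real m + real n)"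
    if special: "aligned C1 C2 \<or> perpendicular_circles C1 C2"
  proof -
    obtain P1 P2 where P: "P1 \<subseteq> C1" "finite P1" "card P1 = m" "P2 \<subseteq> C2" "finite P2" "card P2 = n"
      and D: "num_distances P1 P2 = m + n - 1"
      using ex_few_distances[OF C mn special] .
    \<comment> \<open>Since m + n is at least 2, m + n - 1 is at least half of m + n.\<close>
    have "1 / 2 * (real m + real n) \<le> real (num_distances P1 P2)"
      "real (num_distances P1 P2) \<le> 1 * (real m + real n)" using D mn by simp_all
    with P show ?thesis by blast
  qed
  show "real (num_distances P1 P2) \<ge>
      1 / 224 * Min {real m powr (2/3) * real n powr (2/3), (real m)\<^sup>2, (real n)\<^sup>2}"
    if ns: "\<not> aligned C1 C2 \<and> \<not> perpendicular_circles C1 C2"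
      and P: "P1 \<subseteq> C1 \<and> finite P1 \<and> card P1 = m \<and> P2 \<subseteq> C2 \<and> finite P2 \<and> card P2 = n" for P1 P2
  proof -
    have "P1 \<noteq> {}" "P2 \<noteq> {}" using mn P by auto
    then have "Min {real (card P1) powr (2/3) * real (card P2) powr (2/3),
        (real (card P1))\<^sup>2, (real (card P2))\<^sup>2} \<le> 224 * real (num_distances P1 P2)"
      using ns P by (intro num_distances_ge[OF C]) auto
    then show ?thesis using P by (simp del: Min_insert)
  qed
qed simp_all

end
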